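(* (i) For $0\le\eta\le D$, $V_\eta=\sum\tilde V_{ij}$, where the sum is over all ordered pairs $(i,j)$ with $0\le i,j\le D$ and $i+j=D+\eta$. (ii) For $0\le i,j\le D$ with $i+j<D$, $\tilde V_{ij}=0$. (iii) For $0\le i,j\le D$ with $i+j<D$, $V_{ij}=0$.
   Context: Let $\Gamma=(X,R)$ be a finite connected distance-regular graph with path-length distance $\partial$ and diameter $D\ge3$, $Q$-polynomial with respect to the ordering $E_0,\dots,E_D$ of its primitive idempotents (the primitive idempotents of the Bose–Mesner algebra spanned by the distance matrices; $Q$-polynomial means the Krein parameters $q^h_{ij}$, defined by $E_i\circ E_j=|X|^{-1}\sum_hq^h_{ij}E_h$, vanish whenever one of $h,i,j$ exceeds the sum of the other two and are nonzero whenever one equals the sum of the other two). Let $A$ be the adjacency matrix, $V=\mathbb C^X$ with Hermitean inner product $\langle u,v\rangle=u^t\overline v$. Fix $x\in X$; for $0\le i\le D$ let $E^*_i$ be the diagonal matrix with $(E^*_i)_{yy}=1$ if $\partial(x,y)=i$ and $0$ otherwise; let $A^*$ be the diagonal matrix with $(A^* )_{yy}=|X|(E_1)_{xy}$, and $T$ the algebra generated by $A$ and $A^*$. A $T$-module is a $T$-invariant subspace of $V$; it is irreducible if nonzero with no $T$-submodules other than $0$ and itself. For an irreducible $T$-module $W$ with endpoint $\rho=\min\{i:E^*_iW\ne0\}$, dual endpoint $\tau=\min\{i:E_iW\ne0\}$, and diameter $d=|\{i:E^*_iW\ne0\}|-1$, its displacement is $\rho+\tau+d-D$. For $0\le\eta\le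 D$, $V_\eta$ is the subspace of $V$ spanned by the irreducible $T$-modules of displacement $\eta$. For $-1\le i,j\le D$ define $V_{ij}=(E^*_0V+\cdots+E^*_iV)\cap(E_0V+\cdots+E_jV)$ (so $V_{ij}=0$ if $i=-1$ or $j=-1$). For $0\le i,j\le D$ let $\tilde V_{ij}$ be the orthogonal complement of $V_{i,j-1}+V_{i-1,j}$ in $V_{ij}$. *)

theory Defs
  imports "HOL-Analysis.Analysis"
begin

type_synonym 'x cmat = "complex ^ 'x ^ 'x"
type_synonym 'x cvec = "complex ^ 'x"

definition simple_graph :: "('x \<Rightarrow> 'x \<Rightarrow> bool) \<Rightarrow> bool" where
  "simple_graph adj \<longleftrightarrow> (\<forall>y z. adj y z \<longrightarrow> adj z y) \<and> (\<forall>y. \<not> adj y y)"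

definition connected_graph :: "('x \<Rightarrow> 'x \<Rightarrow> bool) \<Rightarrow> bool" where
  "connected_graph adj \<longleftrightarrow> (\<forall>y z. \<exists>n. (adj ^^ n) y z)"

definition gdist :: "('x \<Rightarrow> 'x \<Rightarrow> bool) \<Rightarrow> 'x \<Rightarrow> 'x \<Rightarrow> nat" where
  "gdist adj y z = (LEAST n. (adj ^^ n) y z)"

definition diameter :: "('x::finite \<Rightarrow> 'x \<Rightarrow> bool) \<Rightarrow> nat" where
  "diameter adj = Max {gdist adj y z | y z. True}"

definition distance_regular :: "('x::finite \<Rightarrow> 'x \<Rightarrow> bool) \<Rightarrow> bool" where
  "distance_regular adj \<longleftrightarrow> simple_graph adj \<and> connected_graph adj \<and>
     (\<forall>i j y z y' z'. gdist adj y z = gdist adj y' z' \<longrightarrow>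
        card {w. gdist adj y w = i \<and> gdist adj z w = j}
      = card {w. gdist adj y' w = i \<and> gdist adj z' w = j})"

definition msc :: "complex \<Rightarrow> 'x::finite cmat \<Rightarrow> 'x cmat" where
  "msc c M = (\<chi> y z. c * M $ y $ z)"

definition hadamard :: "'x::finite cmat \<Rightarrow> 'x cmat \<Rightarrow> 'x cmat" where
  "hadamard M N = (\<chi> y z. M $ y $ z * N $ y $ z)"

definition dist_mat :: "('x::finite \<Rightarrow> 'x \<Rightarrow> bool) \<Rightarrow> nat \<Rightarrow> 'x cmat" where
  "dist_mat adj i = (\<chi> y z. if gdist adj y z = i then 1 else 0)"

definition adj_mat :: "('x::finite \<Rightarrow> 'x \<Rightarrow> bool) \<Rightarrow> 'x cmat" where
  "adj_mat adj = (\<chi> y z. if adj y z then 1 else 0)"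

definition bose_mesner :: "('x::finite \<Rightarrow> 'x \<Rightarrow> bool) \<Rightarrow> 'x cmat set" where
  "bose_mesner adj =
     {(\<Sum>i\<le>diameter adj. msc (c i) (dist_mat adj i)) | c. True}"

definition primitive_idempotent :: "('x::finite \<Rightarrow> 'x \<Rightarrow> bool) \<Rightarrow> 'x cmat \<Rightarrow> bool" where
  "primitive_idempotent adj F \<longleftrightarrow> F \<in> bose_mesner adj \<and> F ** F = F \<and> F \<noteq> 0 \<and>
     (\<forall>G \<in> bose_mesner adj. G ** G = G \<and> G ** F = G \<longrightarrow> G = 0 \<or> G = F)"

text \<open>E_0,...,E_D is an ordering of the primitive idempotents, with the
  standard convention E_0 = |X|^{-1} J\<close>
definition idempotent_ordering :: "('x::finite \<Rightarrow> 'x \<Rightarrow> bool) \<Rightarrow> (nat \<Rightarrow> 'x cmat) \<Rightarrow> bool" where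
  "idempotent_ordering adj E \<longleftrightarrow>
     bij_betw E {..diameter adj} {F. primitive_idempotent adj F} \<and>
     E 0 = (\<chi> y z. 1 / of_nat CARD('x))"

text \<open>Q-polynomial: the Krein parameters q^h_{ij}, defined by
  E_i o E_j = |X|^{-1} sum_h q^h_{ij} E_h (uniquely determined since the E_h are
  linearly independent), satisfy the triangle conditions.  q h i j stands for q^h_{ij}.\<close>
definition Q_polynomial :: "('x::finite \<Rightarrow> 'x \<Rightarrow> bool) \<Rightarrow> (nat \<Rightarrow> 'x cmat) \<Rightarrow> bool" where
  "Q_polynomial adj E \<longleftrightarrow> idempotent_ordering adj E \<and>
     (\<exists>q :: nat \<Rightarrow> nat \<Rightarrow> nat \<Rightarrow> complex.
        (\<forall>i\<le>diameter adj. \<forall>j\<le>diameter adj.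
           hadamard (E i) (E j) =
             msc (1 / of_nat CARD('x)) (\<Sum>h\<le>diameter adj. msc (q h i j) (E h))) \<and>
        (\<forall>h\<le>diameter adj. \<forall>i\<le>diameter adj. \<forall>j\<le>diameter adj.
           ((h > i + j \<or> i > h + j \<or> j > h + i) \<longrightarrow> q h i j = 0) \<and>
           ((h = i + j \<or> i = h + j \<or> j = h + i) \<longrightarrow> q h i j \<noteq> 0)))"

definition dual_idem :: "('x::finite \<Rightarrow> 'x \<Rightarrow> bool) \<Rightarrow> 'x \<Rightarrow> nat \<Rightarrow> 'x cmat" where
  "dual_idem adj x i = (\<chi> y z. if y = z \<and> gdist adj x y = i then 1 else 0)"

definition dual_adj :: "(nat \<Rightarrow> 'x::finite cmat) \<Rightarrow> 'x \<Rightarrow> 'x cmat" where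
  "dual_adj E x = (\<chi> y z. if y = z then of_nat CARD('x) * (E 1) $ x $ y else 0)"

inductive_set T_alg :: "'x::finite cmat \<Rightarrow> 'x cmat \<Rightarrow> 'x cmat set" for A As where
  gen1: "A \<in> T_alg A As"
| gen2: "As \<in> T_alg A As"
| one: "mat 1 \<in> T_alg A As"
| add: "M \<in> T_alg A As \<Longrightarrow> N \<in> T_alg A As \<Longrightarrow> M + N \<in> T_alg A As"
| smult: "M \<in> T_alg A As \<Longrightarrow> msc c M \<in> T_alg A As"
| mult: "M \<in> T_alg A As \<Longrightarrow> N \<in> T_alg A As \<Longrightarrow> M ** N \<in> T_alg A As"

definition T_algebra :: "('x::finite \<Rightarrow> 'x \<Rightarrow> bool) \<Rightarrow> (nat \<Rightarrow> 'x cmat) \<Rightarrow> 'x \<Rightarrow> 'x cmat set" where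
  "T_algebra adj E x = T_alg (adj_mat adj) (dual_adj E x)"

definition T_module :: "('x::finite \<Rightarrow> 'x \<Rightarrow> bool) \<Rightarrow> (nat \<Rightarrow> 'x cmat) \<Rightarrow> 'x \<Rightarrow> 'x cvec set \<Rightarrow> bool" where
  "T_module adj E x W \<longleftrightarrow> vec.subspace W \<and> (\<forall>M \<in> T_algebra adj E x. \<forall>w \<in> W. M *v w \<in> W)"

definition irred_T_module :: "('x::finite \<Rightarrow> 'x \<Rightarrow> bool) \<Rightarrow> (nat \<Rightarrow> 'x cmat) \<Rightarrow> 'x \<Rightarrow> 'x cvec set \<Rightarrow> bool" where
  "irred_T_module adj E x W \<longleftrightarrow> T_module adj E x W \<and> W \<noteq> {0} \<and>
     (\<forall>U. T_module adj E x U \<and> U \<subseteq> W \<longrightarrow> U = {0} \<or> U = W)"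

definition acts_nonzero :: "'x::finite cmat \<Rightarrow> 'x cvec set \<Rightarrow> bool" where
  "acts_nonzero M W \<longleftrightarrow> (\<exists>w\<in>W. M *v w \<noteq> 0)"

definition endpoint :: "('x::finite \<Rightarrow> 'x \<Rightarrow> bool) \<Rightarrow> 'x \<Rightarrow> 'x cvec set \<Rightarrow> nat" where
  "endpoint adj x W = (LEAST i. acts_nonzero (dual_idem adj x i) W)"

definition dual_endpoint :: "(nat \<Rightarrow> 'x::finite cmat) \<Rightarrow> 'x cvec set \<Rightarrow> nat" where
  "dual_endpoint E W = (LEAST i. acts_nonzero (E i) W)"

definition module_diameter :: "('x::finite \<Rightarrow> 'x \<Rightarrow> bool) \<Rightarrow> 'x \<Rightarrow> 'x cvec set \<Rightarrow> int" where
  "module_diameter adj x W =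
     int (card {i. i \<le> diameter adj \<and> acts_nonzero (dual_idem adj x i) W}) - 1"

definition displacement :: "('x::finite \<Rightarrow> 'x \<Rightarrow> bool) \<Rightarrow> (nat \<Rightarrow> 'x cmat) \<Rightarrow> 'x \<Rightarrow> 'x cvec set \<Rightarrow> int" where
  "displacement adj E x W =
     int (endpoint adj x W) + int (dual_endpoint E W) + module_diameter adj x W
     - int (diameter adj)"

definition V_disp :: "('x::finite \<Rightarrow> 'x \<Rightarrow> bool) \<Rightarrow> (nat \<Rightarrow> 'x cmat) \<Rightarrow> 'x \<Rightarrow> nat \<Rightarrow> 'x cvec set" where
  "V_disp adj E x eta =
     vec.span (\<Union> {W. irred_T_module adj E x W \<and> displacement adj E x W = int eta})"

text \<open>V_{ij} for -1 \<le> i,j \<le> D (integer indices)\<close>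
definition V_ij :: "('x::finite \<Rightarrow> 'x \<Rightarrow> bool) \<Rightarrow> (nat \<Rightarrow> 'x cmat) \<Rightarrow> 'x \<Rightarrow> int \<Rightarrow> int \<Rightarrow> 'x cvec set" where
  "V_ij adj E x i j =
     (if i < 0 \<or> j < 0 then {0} else
        vec.span (\<Union>k\<in>{..nat i}. range (\<lambda>v. dual_idem adj x k *v v))
        \<inter> vec.span (\<Union>k\<in>{..nat j}. range (\<lambda>v. E k *v v)))"

definition herm :: "'x::finite cvec \<Rightarrow> 'x cvec \<Rightarrow> complex" where
  "herm u v = (\<Sum>y\<in>UNIV. u $ y * cnj (v $ y))"

definition V_tilde :: "('x::finite \<Rightarrow> 'x \<Rightarrow> bool) \<Rightarrow> (nat \<Rightarrow> 'x cmat) \<Rightarrow> 'x \<Rightarrow> nat \<Rightarrow> nat \<Rightarrow> 'x cvec set" where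
  "V_tilde adj E x i j =
     {v \<in> V_ij adj E x (int i) (int j).
        \<forall>u \<in> vec.span (V_ij adj E x (int i) (int j - 1) \<union> V_ij adj E x (int i - 1) (int j)).
          herm v u = 0}"

end

theory Submission
  imports Defs
begin

text \<open>
  For an irreducible \<open>T\<close>-module \<open>W\<close> put \<open>W\<^sub>a\<^sub>b = V\<^sub>a\<^sub>b \<inter> W\<close>. If \<open>\<theta>\<^sub>b\<close> and \<open>\<theta>\<^sup>*\<^sub>a\<close> are the
  eigenvalues of \<open>A\<close> and \<open>A\<^sup>*\<close>, then \<open>A - \<theta>\<^sub>b\<close> maps \<open>W\<^sub>a\<^sub>b\<close> into the corner \<open>(a + 1, b - 1)\<close> and
  \<open>A\<^sup>* - \<theta>\<^sup>*\<^sub>a\<close> maps it into the corner \<open>(a - 1, b + 1)\<close>, so the sum of all \<open>W\<^sub>a\<^sub>b\<close> with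
  \<open>a + b = s\<close> is a submodule, that is, \<open>0\<close> or \<open>W\<close>. The least \<open>s\<close> for which it is \<open>W\<close> is
  \<open>\<rho> + \<tau> + d = D + \<eta>\<close>. Hence \<open>W\<^sub>a\<^sub>b\<close> vanishes below this level, \<open>W\<close> is the sum of its corners on
  this level, and above it \<open>W\<^sub>a\<^sub>b\<close> is the sum of its two lower neighbours. Orthogonal
  projections onto modules preserve the spaces \<open>V\<^sub>i\<^sub>j\<close>, which transfers these facts to \<open>V\<close>.

  That \<open>\<eta>\<close> is nonnegative is the mean of \<open>2 \<rho> + d \<ge> D\<close> and \<open>2 \<tau> + d \<ge> D\<close>. For the first, a
  nonzero \<open>w\<close> in \<open>E\<^sup>*\<^sub>\<rho> W\<close> is annihilated by a polynomial in \<open>A\<close> of degree \<open>d + 1\<close>; multiplying by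
  distance matrices puts \<open>w\<close> into the span of the \<open>A\<^sub>h w\<close> with \<open>h \<ge> D - d\<close>, and these are orthogonal
  to \<open>w\<close> when \<open>h > 2 \<rho>\<close>. The second is dual.
\<close>

section \<open>Hermitian geometry\<close>

lemma herm_add_left: "herm (u + v) w = herm u w + herm v w"
  by (simp add: herm_def algebra_simps sum.distrib)

lemma herm_add_right: "herm w (u + v) = herm w u + herm w v"
  by (simp add: herm_def algebra_simps sum.distrib)

lemma herm_diff_left: "herm (u - v) w = herm u w - herm v w"
  by (simp add: herm_def algebra_simps sum_subtractf)

lemma herm_minus_left: "herm (- u) w = - herm u w"
  by (simp add: herm_def sum_negf)

lemma herm_scale_left: "herm (c *s u) w = c * herm u w"
  by (simp add: herm_def sum_distrib_left mult.assoc)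

lemma herm_scale_right: "herm w (c *s u) = cnj c * herm w u"
  by (simp add: herm_def sum_distrib_left ac_simps)

lemma herm_commute: "herm v u = cnj (herm u v)"
  by (simp add: herm_def mult.commute)

lemma herm_zero [simp]: "herm 0 u = 0" "herm u 0 = 0"
  by (simp_all add: herm_def)

lemma herm_self: "herm u u = complex_of_real (\<Sum>y\<in>UNIV. (cmod (u $ y))\<^sup>2)"
  by (simp add: herm_def complex_norm_square del: of_real_power)

lemma herm_self_eq_0_iff: "herm u u = 0 \<longleftrightarrow> u = 0"
  by (simp only: herm_self of_real_eq_0_iff) (simp add: sum_nonneg_eq_0_iff vec_eq_iff)

lemma Re_herm: "Re (herm u v) = u \<bullet> v"
  by (simp add: herm_def inner_vec_def inner_complex_def)

lemma subspace_herm_orthogonal: "vec.subspace {v. \<forall>w\<in>W. herm v w = 0}"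
  by (auto simp: vec.subspace_def herm_add_left herm_scale_left)

lemma subspace_herm_orthogonal_right: "vec.subspace {w. herm v w = 0}"
  by (auto simp: vec.subspace_def herm_add_right herm_scale_right)

text \<open>Real orthogonality to a complex subspace is Hermitian orthogonality, because
  the subspace also contains the imaginary multiples of its vectors.\<close>

lemma ex_orthogonal_projection:
  fixes W :: "'x::finite cvec set"
  assumes W: "vec.subspace W"
  obtains y where "y \<in> W" "\<And>w. w \<in> W \<Longrightarrow> herm (v - y) w = 0"
proof -
  have "subspace W"
    unfolding subspace_def
  proof (intro conjI allI ballI)
    fix c and u assume "u \<in> W"
    then have "of_real c *s u \<in> W" using W vec.subspace_scale by blast
    moreover have "of_real c *s u = c *\<^sub>R u"
      by (simp add: vec_eq_iff scaleR_conv_of_real[symmetric])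
    ultimately show "c *\<^sub>R u \<in> W" by simp
  qed (use W in \<open>auto simp: vec.subspace_0 vec.subspace_add\<close>)
  then have span: "span W = W" by (simp add: span_eq_iff)
  obtain y z where yz: "y \<in> span W" "\<And>w. w \<in> span W \<Longrightarrow> orthogonal z w" "v = y + z"
    using orthogonal_subspace_decomp_exists by blast
  have "herm (v - y) w = 0" if w: "w \<in> W" for w
  proof -
    have "\<i> *s w \<in> W" using W w vec.subspace_scale by blast
    then have "Re (herm z w) = 0" "Re (herm z (\<i> *s w)) = 0"
      using yz(2) w span unfolding Re_herm orthogonal_def by blast+
    then show ?thesis
      by (simp add: yz(3) herm_scale_right complex_eq_iff)
  qed
  then show thesis using that yz(1) span by blast
qed

lemma subspace_scale_iff:
  fixes u :: "'x::finite cvec"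
  assumes "vec.subspace W" "c \<noteq> 0"
  shows "c *s u \<in> W \<longleftrightarrow> u \<in> W"
proof
  assume "c *s u \<in> W"
  then have "inverse c *s (c *s u) \<in> W" using assms(1) vec.subspace_scale by blast
  then show "u \<in> W" using assms(2) by simp
qed (use assms vec.subspace_scale in blast)

lemma span_UN_subspaces_decompose:
  fixes S :: "nat \<Rightarrow> 'x::finite cvec set"
  assumes S: "\<And>a. vec.subspace (S a)" and w: "w \<in> vec.span (\<Union>a\<le>n. S a)"
  obtains u where "\<And>a. u a \<in> S a" "w = (\<Sum>a\<le>n. u a)"
proof -
  have "\<exists>u. (\<forall>a. u a \<in> S a) \<and> w = (\<Sum>a\<le>n. u a)"
    using w
  proof (induction rule: vec.span_induct_alt)
    case base
    show ?case using S by (intro exI[of _ "\<lambda>_. 0"]) (simp add: vec.subspace_0)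
  next
    case (step c y z)
    then obtain u b where u: "\<And>a. u a \<in> S a" "z = (\<Sum>a\<le>n. u a)" and b: "b \<le> n" "y \<in> S b"
      by auto
    let ?u = "u(b := c *s y + u b)"
    have "(\<Sum>a\<le>n. ?u a) = (\<Sum>a\<le>n. (if a = b then c *s y else 0) + u a)"
      by (intro sum.cong) auto
    also have "\<dots> = c *s y + z"
      using b u by (simp add: sum.distrib)
    finally have "c *s y + z = (\<Sum>a\<le>n. ?u a)" by simp
    moreover have "\<forall>a. ?u a \<in> S a"
      using u(1) b S by (auto intro: vec.subspace_add vec.subspace_scale)
    ultimately show ?case by blast
  qed
  then show thesis using that by blast
qed

section \<open>Pairs of dual spectral systems\<close>

text \<open>Only the two generators are mentioned; \<open>T_module_iff\<close> shows that this is
  the notion of a \<open>T\<close>-module. The condition is symmetric in \<open>A\<close> and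
  \<open>As\<close>, on which the duality arguments rely.\<close>

definition invariant_subspace :: "'x::finite cmat \<Rightarrow> 'x cmat \<Rightarrow> 'x cvec set \<Rightarrow> bool" where
  "invariant_subspace A As W \<longleftrightarrow>
     vec.subspace W \<and> (\<forall>w\<in>W. A *v w \<in> W) \<and> (\<forall>w\<in>W. As *v w \<in> W)"

definition irreducible_subspace :: "'x::finite cmat \<Rightarrow> 'x cmat \<Rightarrow> 'x cvec set \<Rightarrow> bool" where
  "irreducible_subspace A As W \<longleftrightarrow> invariant_subspace A As W \<and> W \<noteq> {0} \<and>
     (\<forall>U. invariant_subspace A As U \<and> U \<subseteq> W \<longrightarrow> U = {0} \<or> U = W)"

lemma invariant_subspace_swap: "invariant_subspace A As W \<longleftrightarrow> invariant_subspace As A W"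
  by (auto simp: invariant_subspace_def)

lemma irreducible_subspace_swap: "irreducible_subspace A As W \<longleftrightarrow> irreducible_subspace As A W"
  by (simp add: irreducible_subspace_def invariant_subspace_swap[of A])

text \<open>A nonzero invariant subspace of least dimension inside \<open>N\<close> cannot contain a
  smaller nonzero one.\<close>

lemma ex_irreducible_subspace:
  assumes N: "invariant_subspace A As N" and N0: "N \<noteq> {0}"
  obtains W where "irreducible_subspace A As W" "W \<subseteq> N"
proof -
  let ?P = "\<lambda>W. invariant_subspace A As W \<and> W \<noteq> {0} \<and> W \<subseteq> N"
  obtain W where W: "?P W" and least: "\<And>U. ?P U \<Longrightarrow> vec.dim W \<le> vec.dim U"
    using ex_has_least_nat[of ?P N vec.dim] N N0 by auto
  have "irreducible_subspace A As W"
    unfolding irreducible_subspace_def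
  proof (intro conjI allI impI)
    fix U assume U: "invariant_subspace A As U \<and> U \<subseteq> W"
    show "U = {0} \<or> U = W"
    proof (rule disjCI)
      assume "U \<noteq> W"
      show "U = {0}"
      proof (rule ccontr)
        assume "U \<noteq> {0}"
        with U W least have "vec.dim W \<le> vec.dim U" by blast
        with U W have "U = W"
          by (intro vec.subspace_dim_equal) (auto simp: invariant_subspace_def)
        with \<open>U \<noteq> W\<close> show False ..
      qed
    qed
  qed (use W in auto)
  then show thesis using that W by blast
qed

text \<open>One half of the structure: \<open>E\<close> is the family of spectral projections of \<open>A\<close>, \<open>A\<close> is
  tridiagonal with respect to the second family \<open>Es\<close>, and \<open>F\<close> is a sequence of matrices
  commuting with \<open>A\<close> on which multiplication by \<open>A\<close> lowers the index by exactly one.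
  For a distance-regular graph, \<open>F\<close> consists of the distance matrices, and in the dual half
  of the dual distance matrices.\<close>

locale spectral_half =
  fixes D :: nat and A :: "'x::finite cmat" and E :: "nat \<Rightarrow> 'x cmat" and th :: "nat \<Rightarrow> complex"
    and Es :: "nat \<Rightarrow> 'x cmat" and F :: "nat \<Rightarrow> 'x cmat" and q :: "nat \<Rightarrow> nat \<Rightarrow> complex"
  assumes E_herm: "herm (E i *v u) v = herm u (E i *v v)"
    and E_E: "E i *v (E j *v v) = (if i = j then E i *v v else 0)"
    and E_sum: "(\<Sum>i\<le>D. E i *v v) = v"
    and E_beyond: "D < i \<Longrightarrow> E i = 0"
    and A_E: "A *v (E i *v v) = th i *s (E i *v v)"
    and th_inj: "inj_on th {..D}"
    and tridiagonal: "i + 1 < j \<or> j + 1 < i \<Longrightarrow> Es i *v (A *v (Es j *v v)) = 0"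
    and F_0: "F 0 *v v = v"
    and F_A: "F l *v (A *v v) = A *v (F l *v v)"
    and A_F: "1 \<le> l \<Longrightarrow> l \<le> D \<Longrightarrow> A *v (F l *v v) = (\<Sum>h\<le>D. q l h *s (F h *v v))"
    and q_low: "h + 1 < l \<Longrightarrow> l \<le> D \<Longrightarrow> q l h = 0"
    and q_diag: "1 \<le> l \<Longrightarrow> l \<le> D \<Longrightarrow> q l (l - 1) \<noteq> 0"
    and F_vanish: "2 * i < h \<Longrightarrow> Es i *v (F h *v (Es i *v v)) = 0"
begin

lemma A_eq: "A *v v = (\<Sum>i\<le>D. th i *s (E i *v v))"
proof -
  have "A *v v = A *v (\<Sum>i\<le>D. E i *v v)" by (simp add: E_sum)
  then show ?thesis by (simp add: vec.sum A_E)
qed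

lemma E_A: "E i *v (A *v v) = th i *s (E i *v v)"
proof -
  have "E i *v (A *v v) = (\<Sum>j\<le>D. if i = j then th i *s (E i *v v) else 0)"
    unfolding A_eq vec.sum vec.scale E_E by (intro sum.cong) auto
  then show ?thesis by (cases "i \<le> D") (auto simp: E_beyond)
qed

lemma eq_0_if_all_E_0: "(\<And>i. E i *v v = 0) \<Longrightarrow> v = 0"
  using E_sum[of v] by simp

text \<open>The \<open>E k\<close> are mutually orthogonal idempotents with sum 1, so a vector lies
  in the sum of the first eigenspaces iff its other components vanish. In this form
  \<open>V_ij\<close> becomes a \<open>corner\<close>.\<close>

lemma span_range_E:
  "vec.span (\<Union>k\<in>{..j}. range (\<lambda>v. E k *v v)) = {v. \<forall>k>j. E k *v v = 0}" (is "?L = ?R")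
proof
  show "?L \<subseteq> ?R"
  proof (rule vec.span_minimal)
    show "(\<Union>k\<in>{..j}. range (\<lambda>v. E k *v v)) \<subseteq> ?R" by (auto simp: E_E)
    show "vec.subspace ?R" by (auto simp: vec.subspace_def vec.add vec.scale)
  qed
  show "?R \<subseteq> ?L"
  proof
    fix v assume v: "v \<in> ?R"
    have "E k *v v \<in> ?L" for k
    proof (cases "k \<le> j")
      case True
      then show ?thesis by (intro vec.span_base) auto
    next
      case False
      with v show ?thesis by (simp add: vec.span_zero)
    qed
    then have "(\<Sum>k\<le>D. E k *v v) \<in> ?L" by (intro vec.span_sum)
    then show "v \<in> ?L" by (simp only: E_sum)
  qed
qed

text \<open>Induction on the number of eigencomponents: \<open>A - th k\<close> kills component
  \<open>k\<close> and multiplies the others by nonzero scalars, the eigenvalues being distinct.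
  This replaces writing \<open>E i\<close> as a polynomial in \<open>A\<close>.\<close>

lemma E_mem_of_A_invariant:
  assumes W: "vec.subspace W" "\<And>w. w \<in> W \<Longrightarrow> A *v w \<in> W" and w: "w \<in> W"
  shows "E i *v w \<in> W"
proof -
  have "\<forall>i\<in>S. u i \<in> W"
    if "finite S" "S \<subseteq> {..D}" "\<And>i. i \<in> S \<Longrightarrow> A *v u i = th i *s u i" "(\<Sum>i\<in>S. u i) \<in> W"
    for S and u :: "nat \<Rightarrow> 'x cvec"
    using that
  proof (induction S arbitrary: u rule: finite_induct)
    case (insert k S)
    let ?t = "\<Sum>i\<in>insert k S. u i"
    have "A *v ?t - th k *s ?t = (\<Sum>i\<in>insert k S. th i *s u i - th k *s u i)"
      using insert.prems(2) by (simp add: vec.sum sum_subtractf vec.scale_sum_right vec.add vec.scale_right_distrib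
        sum.cong[of S S "\<lambda>i. A *v u i" "\<lambda>i. th i *s u i"])
    also have "\<dots> = (\<Sum>i\<in>S. (th i - th k) *s u i)"
      using insert.hyps by (simp add: vec.scale_left_diff_distrib)
    finally have "(\<Sum>i\<in>S. (th i - th k) *s u i) \<in> W"
      using W insert.prems(3) by (metis vec.subspace_diff vec.subspace_scale)
    then have "\<forall>i\<in>S. (th i - th k) *s u i \<in> W"
      using insert.prems by (intro insert.IH) (auto simp: vec.scale vec.diff mult.commute)
    moreover have "th i - th k \<noteq> 0" if "i \<in> S" for i
      using that insert.hyps(2) insert.prems(1) inj_onD[OF th_inj, of i k] by auto
    ultimately have S: "\<forall>i\<in>S. u i \<in> W"
      using subspace_scale_iff[OF W(1)] by meson
    then have "(\<Sum>i\<in>S. u i) \<in> W" by (simp add: vec.subspace_sum[OF W(1)])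
    moreover have "u k = ?t - (\<Sum>i\<in>S. u i)" using insert.hyps by simp
    ultimately have "u k \<in> W" using insert.prems(3) vec.subspace_diff[OF W(1)] by metis
    with S show ?case by blast
  qed simp
  from this[of "{..D}" "\<lambda>i. E i *v w"] show ?thesis
    using w W(1) by (cases "i \<le> D") (auto simp: A_E E_sum E_beyond vec.subspace_0)
qed

text \<open>\<open>A\<close> is not assumed self-adjoint, since its eigenvalues may be any complex
  numbers; but the \<open>E i\<close> are, and \<open>A\<close> is a combination of them.\<close>

lemma orthogonal_complement_A_invariant:
  assumes "\<And>w i. w \<in> W \<Longrightarrow> E i *v w \<in> W" and "\<forall>w\<in>W. herm v w = 0"
  shows "\<forall>w\<in>W. herm (A *v v) w = 0"
proof -
  have "\<forall>w\<in>W. herm (E i *v v) w = 0" for i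
    using assms by (auto simp: E_herm)
  then have "E i *v v \<in> {v. \<forall>w\<in>W. herm v w = 0}" for i by blast
  then have "A *v v \<in> {v. \<forall>w\<in>W. herm v w = 0}"
    unfolding A_eq by (intro vec.subspace_sum vec.subspace_scale subspace_herm_orthogonal)
  then show ?thesis by blast
qed

text \<open>As \<open>E i\<close> is self-adjoint and preserves \<open>W\<close>, the vector
  \<open>E i *v (v - y)\<close> is orthogonal to \<open>E i *v y\<close>. With
  \<open>E i *v v = 0\<close> this makes \<open>E i *v y\<close> orthogonal to itself.\<close>

lemma projection_E_eq_0:
  assumes W: "vec.subspace W" "\<And>w i. w \<in> W \<Longrightarrow> E i *v w \<in> W"
    and y: "y \<in> W" "\<And>w. w \<in> W \<Longrightarrow> herm (v - y) w = 0" and v: "E i *v v = 0"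
  shows "E i *v y = 0"
proof -
  have "herm (E i *v (v - y)) (E i *v y) = 0"
    using W y by (simp add: E_herm)
  then have "herm (E i *v y) (E i *v y) = 0"
    using v by (simp add: vec.diff herm_minus_left)
  then show ?thesis by (simp add: herm_self_eq_0_iff)
qed

text \<open>By \<open>q_low\<close>, multiplication by \<open>A\<close> lowers the index in
  \<open>F\<close> by at most one.\<close>

lemma A_mem_span_F:
  assumes x: "x \<in> vec.span ((\<lambda>h. F h *v w) ` {Suc m..D})"
  shows "A *v x - c *s x \<in> vec.span ((\<lambda>h. F h *v w) ` {m..D})"
proof -
  let ?Z = "vec.span ((\<lambda>h. F h *v w) ` {m..D})"
  have "vec.subspace {x. A *v x - c *s x \<in> ?Z}"
    unfolding vec.subspace_def
  proof (intro conjI allI ballI)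
    fix r y z assume yz: "y \<in> {x. A *v x - c *s x \<in> ?Z}" "z \<in> {x. A *v x - c *s x \<in> ?Z}"
    have eq: "A *v (y + z) - c *s (y + z) = (A *v y - c *s y) + (A *v z - c *s z)"
      by (simp add: vec.add vec.scale_right_distrib)
    show "y + z \<in> {x. A *v x - c *s x \<in> ?Z}"
      using yz unfolding mem_Collect_eq eq by (blast intro: vec.span_add)
    have eq: "A *v (r *s y) - c *s (r *s y) = r *s (A *v y - c *s y)"
      by (simp add: vec.scale vec.scale_right_diff_distrib mult.commute)
    show "r *s y \<in> {x. A *v x - c *s x \<in> ?Z}"
      using yz unfolding mem_Collect_eq eq by (blast intro: vec.span_scale)
  qed (simp add: vec.span_zero)
  moreover have "A *v (F h *v w) - c *s (F h *v w) \<in> ?Z" if h: "h \<in> {Suc m..D}" for h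
  proof -
    have "q h k *s (F k *v w) \<in> ?Z" if "k \<le> D" for k
    proof (cases "m \<le> k")
      case True
      with that show ?thesis by (intro vec.span_scale vec.span_base) auto
    next
      case False
      with h show ?thesis by (simp add: q_low vec.span_zero)
    qed
    then have "A *v (F h *v w) \<in> ?Z"
      using h by (auto simp: A_F intro: vec.span_sum)
    moreover have "F h *v w \<in> ?Z" using h by (intro vec.span_base) auto
    ultimately show ?thesis by (intro vec.span_diff vec.span_scale)
  qed
  ultimately show ?thesis
    by (intro vec.span_induct[OF x, of "\<lambda>x. A *v x - c *s x \<in> ?Z"]) (assumption, clarify)
qed

text \<open>Multiplying \<open>F l *v w\<close> by the annihilating polynomial of \<open>w\<close>, of degree \<open>e\<close>, gives a
  relation whose lowest term is a nonzero multiple of \<open>F (l - e) *v w\<close>.\<close>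

lemma mem_span_high_F:
  assumes w: "\<And>k. E k *v w \<noteq> 0 \<Longrightarrow> t \<le> k \<and> k < t + e" and e: "e \<le> D"
  shows "w \<in> vec.span ((\<lambda>h. F h *v w) ` {Suc (D - e)..D})"
proof -
  let ?Z = "\<lambda>m. vec.span ((\<lambda>h. F h *v w) ` {m..D})"
  \<comment> \<open>\<open>y n\<close> is \<open>w\<close> multiplied by the first \<open>n\<close>
    factors \<open>A - th (t + i)\<close>. Since \<open>w\<close> has components only at the indices
    from \<open>t\<close> to \<open>t + e - 1\<close>, \<open>y e\<close> vanishes.\<close>
  define y where "y = rec_nat w (\<lambda>n z. A *v z - th (t + n) *s z)"
  have y_0: "y 0 = w" and y_Suc: "y (Suc n) = A *v y n - th (t + n) *s y n" for n
    by (simp_all add: y_def)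
  have E_y: "E k *v y n = (\<Prod>i<n. th k - th (t + i)) *s (E k *v w)" for k n
    by (induction n) (simp_all add: y_0 y_Suc vec.diff vec.scale E_A vec.scale_left_diff_distrib
        algebra_simps)
  have "E k *v y e = 0" for k
  proof (cases "E k *v w = 0")
    case False
    with w have "k - t < e \<and> th k - th (t + (k - t)) = 0" by force
    then have "(\<Prod>i<e. th k - th (t + i)) = 0" by (intro prod_zero) auto
    then show ?thesis by (simp add: E_y)
  qed (simp add: E_y)
  then have y_e: "y e = 0" by (rule eq_0_if_all_E_0)
  \<comment> \<open>Each factor lowers the least index by exactly one: the lowest coefficient is
    multiplied by \<open>q (Suc m) m\<close>, nonzero by \<open>q_diag\<close>, and everything else
    stays at higher indices.\<close>
  have lowest: "\<exists>b. b \<noteq> 0 \<and> F l *v y n - b *s (F (l - n) *v w) \<in> ?Z (Suc (l - n))"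
    if "n \<le> l" "l \<le> D" for n l
    using that(1)
  proof (induction n)
    case 0
    show ?case by (intro exI[of _ 1]) (simp add: y_0 vec.span_zero)
  next
    case (Suc n)
    then obtain b where b: "b \<noteq> 0" and z: "F l *v y n - b *s (F (l - n) *v w) \<in> ?Z (Suc (l - n))"
      by auto
    define z where "z = F l *v y n - b *s (F (l - n) *v w)"
    define m where "m = l - Suc n"
    have m: "l - n = Suc m" "Suc m \<le> D" using Suc.prems that by (auto simp: m_def)
    let ?c = "th (t + n)"
    have Az: "A *v z - ?c *s z \<in> ?Z (Suc m)"
      using A_mem_span_F[of z w "Suc m" ?c] z by (simp add: z_def m)
    have sub: "F h *v w \<in> ?Z (Suc m)" if "Suc m \<le> h" "h \<le> D" for h
      using that by (intro vec.span_base) auto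
    have "(\<Sum>h\<le>D. q (Suc m) h *s (F h *v w)) - q (Suc m) m *s (F m *v w)
        = (\<Sum>h\<in>{..D} - {m}. q (Suc m) h *s (F h *v w))"
      using m by (subst sum.remove[of _ m]) auto
    moreover have "q (Suc m) h *s (F h *v w) \<in> ?Z (Suc m)" if "h \<in> {..D} - {m}" for h
    proof (cases "h < m")
      case True
      with m show ?thesis by (simp add: q_low vec.span_zero)
    next
      case False
      with that show ?thesis by (intro vec.span_scale sub) auto
    qed
    then have "(\<Sum>h\<in>{..D} - {m}. q (Suc m) h *s (F h *v w)) \<in> ?Z (Suc m)"
      by (rule vec.span_sum)
    ultimately have "A *v (F (Suc m) *v w) - q (Suc m) m *s (F m *v w) \<in> ?Z (Suc m)"
      using m by (simp add: A_F)
    then have "b *s (A *v (F (Suc m) *v w) - q (Suc m) m *s (F m *v w))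
        - (b * ?c) *s (F (Suc m) *v w) + (A *v z - ?c *s z) \<in> ?Z (Suc m)"
      using Az m(2)
      by (blast intro: vec.span_add[OF vec.span_diff[OF vec.span_scale vec.span_scale[OF sub]]])
    also have "b *s (A *v (F (Suc m) *v w) - q (Suc m) m *s (F m *v w))
        - (b * ?c) *s (F (Suc m) *v w) + (A *v z - ?c *s z)
        = F l *v y (Suc n) - (b * q (Suc m) m) *s (F m *v w)"
      by (simp add: y_Suc z_def m vec.diff vec.scale F_A vec.scale_right_diff_distrib mult.commute)
    finally show ?case
      using b m q_diag[of "Suc m"] by (intro exI[of _ "b * q (Suc m) m"]) (simp add: m_def)
  qed
  \<comment> \<open>This is \<open>lowest\<close> with \<open>n = e\<close> and
    \<open>l = m + e\<close>: since \<open>y e = 0\<close>, the lowest term is a combination of the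
    higher ones.\<close>
  have relation: "F m *v w \<in> ?Z (Suc m)" if m: "m + e \<le> D" for m
  proof -
    obtain b where b: "b \<noteq> 0" "- (b *s (F m *v w)) \<in> ?Z (Suc m)"
      using lowest[OF le_add2 m] by (auto simp: y_e)
    then have "(- 1 / b) *s - (b *s (F m *v w)) \<in> ?Z (Suc m)" by (intro vec.span_scale)
    then show ?thesis using b by simp
  qed
  \<comment> \<open>The relations eliminate the lowest generator one after another until the index
    exceeds \<open>D - e\<close>. The start \<open>m = 0\<close> covers
    \<open>F 0 *v w = w\<close>.\<close>
  have "?Z m \<subseteq> ?Z (Suc (D - e))" if "m \<le> Suc (D - e)" for m
    using that
  proof (induction m rule: inc_induct)
    case (step n)
    have "?Z n \<subseteq> ?Z (Suc n)"
    proof (rule vec.span_minimal)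
      show "(\<lambda>h. F h *v w) ` {n..D} \<subseteq> ?Z (Suc n)"
      proof clarify
        fix h assume h: "h \<in> {n..D}"
        show "F h *v w \<in> ?Z (Suc n)"
        proof (cases "h = n")
          case True
          then show ?thesis using relation[of n] step.hyps e by simp
        next
          case False
          with h show ?thesis by (intro vec.span_base) auto
        qed
      qed
    qed simp
    with step.IH show ?case by blast
  qed simp
  from this[of 0] have "F 0 *v w \<in> ?Z (Suc (D - e))"
    by (meson atLeastAtMost_iff image_eqI le0 subsetD vec.span_base)
  then show ?thesis by (simp add: F_0)
qed

end

section \<open>Corners and supports of a subspace\<close>

definition corner :: "(nat \<Rightarrow> 'x::finite cmat) \<Rightarrow> (nat \<Rightarrow> 'x cmat) \<Rightarrow> 'x cvec set \<Rightarrow> nat \<Rightarrow> nat \<Rightarrow> 'x cvec set"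
  where "corner Es E W i j = {w \<in> W. (\<forall>k>i. Es k *v w = 0) \<and> (\<forall>k>j. E k *v w = 0)}"

definition support :: "(nat \<Rightarrow> 'x::finite cmat) \<Rightarrow> 'x cvec set \<Rightarrow> nat set" where
  "support E W = {i. acts_nonzero (E i) W}"

lemma subspace_corner: "vec.subspace W \<Longrightarrow> vec.subspace (corner Es E W i j)"
  by (auto simp: vec.subspace_def corner_def vec.add vec.scale)

lemma corner_swap: "corner Es E W i j = corner E Es W j i"
  by (auto simp: corner_def)

lemma corner_mono: "i \<le> i' \<Longrightarrow> j \<le> j' \<Longrightarrow> corner Es E W i j \<subseteq> corner Es E W i' j'"
  by (auto simp: corner_def)

context spectral_half
begin

lemma finite_support: "finite (support E W)"
proof (rule finite_subset)
  show "support E W \<subseteq> {..D}"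
    using E_beyond by (force simp: support_def acts_nonzero_def not_le[symmetric])
qed simp

lemma support_le: "i \<in> support E W \<Longrightarrow> i \<le> D"
  using E_beyond by (force simp: support_def acts_nonzero_def not_le[symmetric])

lemma support_nonempty:
  assumes "vec.subspace W" "W \<noteq> {0}"
  shows "support E W \<noteq> {}"
proof -
  obtain w where "w \<in> W" "w \<noteq> 0" using assms vec.subspace_0 by blast
  then show ?thesis using eq_0_if_all_E_0[of w] by (auto simp: support_def acts_nonzero_def)
qed

lemma E_eq_0_outside_support:
  assumes "w \<in> W" "k < Min (support E W) \<or> Max (support E W) < k"
  shows "E k *v w = 0"
proof (rule ccontr)
  assume "E k *v w \<noteq> 0"
  then have "k \<in> support E W" using assms(1) by (auto simp: support_def acts_nonzero_def)
  then show False using assms(2) finite_support by (metis Max_ge Min_le leD)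
qed

end

section \<open>Invariant subspaces and their sums of corners\<close>

locale dual_spectral_pair =
  spectral_half D A E th Es F q + dual: spectral_half D As Es ths E Fs qs
  for D :: nat and A :: "'x::finite cmat" and E th Es F q As ths Fs qs
begin

text \<open>The two halves enter symmetrically, so a fact proved for \<open>A\<close> and
  \<open>E\<close> yields its dual by interpretation with the roles exchanged.\<close>

lemma swapped: "dual_spectral_pair D As Es ths E Fs qs A th F q"
  by (intro dual_spectral_pair.intro dual.spectral_half_axioms spectral_half_axioms)

lemma E_mem:
  assumes "invariant_subspace A As W" "w \<in> W"
  shows "E i *v w \<in> W" "Es i *v w \<in> W"
  using assms E_mem_of_A_invariant dual.E_mem_of_A_invariant
  by (auto simp: invariant_subspace_def)

text \<open>\<open>W\<close> is any set closed under the projections; it will be a union of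
  submodules, which in general is not a subspace.\<close>

lemma invariant_orthogonal_complement:
  assumes W: "\<And>w i. w \<in> W \<Longrightarrow> E i *v w \<in> W" "\<And>w i. w \<in> W \<Longrightarrow> Es i *v w \<in> W"
  shows "invariant_subspace A As {v. \<forall>w\<in>W. herm v w = 0}"
  using orthogonal_complement_A_invariant[of W] dual.orthogonal_complement_A_invariant[of W] W
  by (auto simp: invariant_subspace_def subspace_herm_orthogonal)

text \<open>This stands in for complete reducibility. The vectors orthogonal to all irreducible
  submodules form a submodule. An irreducible one inside it would be orthogonal to itself, so that
  submodule is zero.\<close>

lemma eq_0_if_orthogonal_to_irreducibles:
  assumes "\<And>W w. irreducible_subspace A As W \<Longrightarrow> w \<in> W \<Longrightarrow> herm v w = 0"
  shows "v = 0"
proof -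
  let ?U = "\<Union> {W. irreducible_subspace A As W}"
  let ?N = "{v. \<forall>w\<in>?U. herm v w = 0}"
  have "invariant_subspace A As ?N"
    by (rule invariant_orthogonal_complement)
       (auto simp: irreducible_subspace_def intro: E_mem)
  moreover have "irreducible_subspace A As W \<Longrightarrow> W \<subseteq> ?N \<Longrightarrow> False" for W
  proof -
    assume W: "irreducible_subspace A As W" "W \<subseteq> ?N"
    then have "w = 0" if "w \<in> W" for w
      using that by (auto simp: herm_self_eq_0_iff[symmetric])
    then show False using W(1)
      by (auto simp: irreducible_subspace_def invariant_subspace_def dest: vec.subspace_0)
  qed
  ultimately have "?N = {0}" using ex_irreducible_subspace by blast
  moreover have "v \<in> ?N" using assms by auto
  ultimately show ?thesis by blast
qed

lemma projection_mem_corner: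
  assumes W: "invariant_subspace A As W" and v: "v \<in> corner Es E UNIV i j"
    and y: "y \<in> W" "\<And>w. w \<in> W \<Longrightarrow> herm (v - y) w = 0"
  shows "y \<in> corner Es E W i j"
proof -
  have "vec.subspace W" using W by (simp add: invariant_subspace_def)
  then show ?thesis
    using v y projection_E_eq_0[OF _ E_mem(1)[OF W] y] dual.projection_E_eq_0[OF _ E_mem(2)[OF W] y]
    by (auto simp: corner_def)
qed

lemma A_mem_corner_sum:
  assumes W: "invariant_subspace A As W" and a: "a \<le> s" and u: "u \<in> corner Es E W a (s - a)"
  shows "A *v u \<in> vec.span (\<Union>a\<le>s. corner Es E W a (s - a))"
proof -
  let ?S = "vec.span (\<Union>a\<le>s. corner Es E W a (s - a))"
  let ?c = "th (s - a)"
  define z where "z = A *v u - ?c *s u"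
  have uW: "u \<in> W" using u by (simp add: corner_def)
  then have zW: "z \<in> W"
    using W unfolding z_def
    by (intro vec.subspace_diff vec.subspace_scale) (auto simp: invariant_subspace_def)
  have E_z: "E k *v z = 0" if "k \<ge> s - a" for k
  proof (cases "k = s - a")
    case False
    with that u have "E k *v u = 0" by (simp add: corner_def)
    then show ?thesis by (simp add: z_def vec.diff vec.scale E_A)
  qed (simp add: z_def vec.diff vec.scale E_A)
  \<comment> \<open>Tridiagonality: \<open>A\<close> raises the index of an
    \<open>Es\<close>-component by at most one.\<close>
  have Es_z: "Es k *v z = 0" if k: "k > Suc a" for k
  proof -
    have "Es k *v (A *v (Es j *v u)) = 0" for j
      using u tridiagonal[of k j u] k by (cases "j \<le> a") (auto simp: corner_def)
    then have "Es k *v (A *v (\<Sum>j\<le>D. Es j *v u)) = 0" by (simp add: vec.sum)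
    then show ?thesis using u k by (simp add: z_def vec.diff vec.scale dual.E_sum corner_def)
  qed
  have "z \<in> ?S"
  proof (cases "a = s")
    \<comment> \<open>Here \<open>s - a = 0\<close> and there is no corner
      \<open>(s + 1, -1)\<close>; instead all components \<open>E k *v z\<close> vanish.\<close>
    case True
    then have "z = 0" by (intro eq_0_if_all_E_0[of z] E_z) simp
    then show ?thesis by (simp add: vec.span_zero)
  next
    case False
    then have "z \<in> corner Es E W (Suc a) (s - Suc a)"
      using a zW E_z Es_z by (auto simp: corner_def)
    with False a show ?thesis by (intro vec.span_base) (auto intro!: bexI[of _ "Suc a"])
  qed
  moreover have "u \<in> ?S" using u a by (intro vec.span_base) auto
  ultimately have "z + ?c *s u \<in> ?S" by (intro vec.span_add vec.span_scale)
  then show ?thesis by (simp add: z_def)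
qed

text \<open>Reindexing the antidiagonal by \<open>s - a\<close> turns
  \<open>A_mem_corner_sum\<close> for the exchanged pair into a statement about
  \<open>As\<close>.\<close>

lemma corner_sum_swap:
  "(\<Union>a\<le>s. corner E Es W a (s - a)) = (\<Union>a\<le>s. corner Es E W a (s - a))"
proof -
  have "(\<Union>a\<le>s. corner E Es W a (s - a)) \<subseteq> (\<Union>a\<le>s. corner Es E W a (s - a))" for E Es :: "nat \<Rightarrow> 'x cmat"
  proof (rule UN_least)
    fix a assume "a \<in> {..s}"
    then show "corner E Es W a (s - a) \<subseteq> (\<Union>a\<le>s. corner Es E W a (s - a))"
      by (subst corner_swap) (auto intro!: bexI[of _ "s - a"])
  qed
  then show ?thesis by blast
qed

lemma corner_sum_invariant:
  assumes W: "invariant_subspace A As W"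
  shows "invariant_subspace A As (vec.span (\<Union>a\<le>s. corner Es E W a (s - a)))"
proof -
  interpret sw: dual_spectral_pair D As Es ths E Fs qs A th F q by (rule swapped)
  let ?C = "\<Union>a\<le>s. corner Es E W a (s - a)"
  have closed: "B *v w \<in> vec.span ?C"
    if "\<And>u. u \<in> ?C \<Longrightarrow> B *v u \<in> vec.span ?C" "w \<in> vec.span ?C" for B w
    using that(2)
    by (rule vec.span_induct)
       (auto simp: vec.subspace_def vec.add vec.scale vec.span_zero that(1)
         intro: vec.span_add vec.span_scale)
  have "A *v u \<in> vec.span ?C" if "u \<in> ?C" for u
    using that A_mem_corner_sum[OF W] by auto
  moreover have "As *v u \<in> vec.span ?C" if "u \<in> ?C" for u
  proof -
    have "u \<in> (\<Union>a\<le>s. corner E Es W a (s - a))" using that corner_sum_swap by simp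
    then show ?thesis
      using sw.A_mem_corner_sum[of W _ s u] W invariant_subspace_swap corner_sum_swap by force
  qed
  ultimately show ?thesis
    using closed by (simp add: invariant_subspace_def)
qed

end

section \<open>Corners of a single irreducible module\<close>

locale irreducible_module = dual_spectral_pair +
  fixes W
  assumes irr: "irreducible_subspace A As W"
begin

abbreviation "rho \<equiv> Min (support Es W)"
abbreviation "rho' \<equiv> Max (support Es W)"
abbreviation "tau \<equiv> Min (support E W)"
abbreviation "tau' \<equiv> Max (support E W)"

lemma inv: "invariant_subspace A As W" and sub: "vec.subspace W" and nonzero: "W \<noteq> {0}"
  using irr by (auto simp: irreducible_subspace_def invariant_subspace_def)

lemma swapped_module: "irreducible_module D As Es ths E Fs qs A th F q W"
  using swapped irr irreducible_subspace_swap
  by (intro irreducible_module.intro irreducible_module_axioms.intro) auto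

lemma corner_sum_cases:
  "vec.span (\<Union>a\<le>s. corner Es E W a (s - a)) = {0} \<or>
   vec.span (\<Union>a\<le>s. corner Es E W a (s - a)) = W"
proof -
  have "vec.span (\<Union>a\<le>s. corner Es E W a (s - a)) \<subseteq> W"
    by (rule vec.span_minimal) (auto simp: corner_def sub)
  then show ?thesis
    using irr corner_sum_invariant[OF inv] by (simp add: irreducible_subspace_def)
qed

lemma corner_low:
  assumes u: "u \<in> corner Es E W a b" and low: "a < rho \<or> b < tau"
  shows "u = 0"
proof -
  have uW: "u \<in> W" using u by (simp add: corner_def)
  show ?thesis
  proof (cases "a < rho")
    case True
    then have "Es k *v u = 0" for k
      using u dual.E_eq_0_outside_support[OF uW, of k] by (cases "k \<le> a") (auto simp: corner_def)
    then show ?thesis by (rule dual.eq_0_if_all_E_0)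
  next
    case False
    then have "E k *v u = 0" for k
      using u low E_eq_0_outside_support[OF uW, of k] by (cases "k \<le> b") (auto simp: corner_def)
    then show ?thesis by (rule eq_0_if_all_E_0)
  qed
qed

text \<open>Nonzero corners have \<open>a\<close> at least \<open>rho\<close>, hence no
  \<open>E\<close>-components above \<open>s - rho\<close>; if they span \<open>W\<close>, then
  \<open>tau'\<close> is at most \<open>s - rho\<close>. The other bound is the same argument with
  \<open>tau\<close>.\<close>

lemma corner_sum_ge:
  assumes s: "vec.span (\<Union>a\<le>s. corner Es E W a (s - a)) = W"
  shows "rho + tau' \<le> s" "rho' + tau \<le> s"
proof -
  have zero: "B *v w = 0" if "\<And>u a. a \<le> s \<Longrightarrow> u \<in> corner Es E W a (s - a) \<Longrightarrow> u \<noteq> 0 \<Longrightarrow> B *v u = 0"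
    and "w \<in> W" for B w
  proof -
    have "w \<in> vec.span (\<Union>a\<le>s. corner Es E W a (s - a))" using that(2) s by simp
    then show ?thesis
    proof (rule vec.span_induct)
      show "vec.subspace {w. B *v w = 0}" by (simp add: vec.subspace_def vec.add vec.scale)
      show "B *v u = 0" if "u \<in> (\<Union>a\<le>s. corner Es E W a (s - a))" for u
        using that \<open>\<And>u a. a \<le> s \<Longrightarrow> u \<in> corner Es E W a (s - a) \<Longrightarrow> u \<noteq> 0 \<Longrightarrow> B *v u = 0\<close>
        by (cases "u = 0") auto
    qed
  qed
  have "E k *v w = 0" if k: "s < k + rho" and w: "w \<in> W" for k w
    using w
  proof (rule zero[rotated])
    fix u a assume u: "a \<le> s" "u \<in> corner Es E W a (s - a)" "u \<noteq> 0"
    then have "rho \<le> a" using corner_low by (metis not_le)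
    with u k show "E k *v u = 0" by (auto simp: corner_def)
  qed
  moreover have "Es k *v w = 0" if k: "s < k + tau" and w: "w \<in> W" for k w
    using w
  proof (rule zero[rotated])
    fix u a assume u: "a \<le> s" "u \<in> corner Es E W a (s - a)" "u \<noteq> 0"
    then have "tau \<le> s - a" using corner_low by (metis not_le)
    with u k show "Es k *v u = 0" by (auto simp: corner_def)
  qed
  moreover have "tau' \<in> support E W" "rho' \<in> support Es W"
    using finite_support dual.finite_support support_nonempty dual.support_nonempty sub nonzero Max_in
    by blast+
  ultimately have "\<not> s < tau' + rho" "\<not> s < rho' + tau"
    by (auto simp: support_def acts_nonzero_def)
  then show "rho + tau' \<le> s" "rho' + tau \<le> s" by auto
qed

text \<open>A nonzero vector \<open>E tau *v w\<close> with \<open>w\<close> in \<open>W\<close>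
  lies in the corner \<open>(rho', tau)\<close>, so the span on this level is not
  \<open>{0}\<close>.\<close>

lemma corner_sum_eq: "vec.span (\<Union>a\<le>rho' + tau. corner Es E W a (rho' + tau - a)) = W"
proof -
  have "tau \<in> support E W"
    using finite_support support_nonempty sub nonzero Min_in by blast
  then obtain w where w: "w \<in> W" "E tau *v w \<noteq> 0" by (auto simp: support_def acts_nonzero_def)
  have Ew: "E tau *v w \<in> W" using w E_mem inv by blast
  have "E tau *v w \<in> corner Es E W rho' tau"
    using Ew dual.E_eq_0_outside_support[OF Ew] by (auto simp: corner_def E_E)
  then have "E tau *v w \<in> vec.span (\<Union>a\<le>rho' + tau. corner Es E W a (rho' + tau - a))"
    by (intro vec.span_base) (auto intro!: bexI[of _ rho'])
  then show ?thesis using w corner_sum_cases by blast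
qed

text \<open>\<open>corner_sum_ge\<close> on the level \<open>rho' + tau\<close> gives one
  inequality, the exchanged pair on its level \<open>tau' + rho\<close> the other. So the diameter
  and the dual diameter of \<open>W\<close> agree.\<close>

lemma diameters_eq: "rho + tau' = rho' + tau"
proof -
  interpret sw: irreducible_module D As Es ths E Fs qs A th F q W by (rule swapped_module)
  show ?thesis
    using corner_sum_ge[OF corner_sum_eq] sw.corner_sum_ge[OF sw.corner_sum_eq] by simp
qed

lemma corner_eq_0:
  assumes "i + j < rho' + tau"
  shows "corner Es E W i j = {0}"
proof -
  have "vec.span (\<Union>a\<le>i + j. corner Es E W a (i + j - a)) \<noteq> W"
    using assms corner_sum_ge(2)[of "i + j"] by auto
  then have "vec.span (\<Union>a\<le>i + j. corner Es E W a (i + j - a)) = {0}"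
    using corner_sum_cases by blast
  moreover have "corner Es E W i j \<subseteq> vec.span (\<Union>a\<le>i + j. corner Es E W a (i + j - a))"
    by (rule subset_trans[OF _ vec.span_superset]) (auto intro!: bexI[of _ i])
  ultimately show ?thesis using subspace_corner[OF sub] vec.subspace_0 by blast
qed

text \<open>If an index \<open>k\<close> between the ends were missing, the vectors of
  \<open>W\<close> with components only below \<open>k\<close> would form a proper nonzero
  submodule, since \<open>A\<close> cannot step over \<open>k\<close>. Hence the cardinality in
  \<open>module_diameter\<close> is \<open>rho' - rho + 1\<close>.\<close>

lemma support_interval: "support Es W = {rho..rho'}"
proof
  show "support Es W \<subseteq> {rho..rho'}"
    using dual.finite_support by auto
  show "{rho..rho'} \<subseteq> support Es W"
  proof (rule ccontr)
    assume "\<not> {rho..rho'} \<subseteq> support Es W"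
    then obtain k where k: "rho \<le> k" "k \<le> rho'" "k \<notin> support Es W"
      by (meson atLeastAtMost_iff subsetI)
    have ends: "rho \<in> support Es W" "rho' \<in> support Es W"
      using dual.finite_support dual.support_nonempty sub nonzero Min_in Max_in by blast+
    define U where "U = {w \<in> W. \<forall>j\<ge>k. Es j *v w = 0}"
    have Es_k: "Es k *v w = 0" if "w \<in> W" for w
      using k(3) that by (auto simp: support_def acts_nonzero_def)
    have "invariant_subspace A As U"
      unfolding invariant_subspace_def
    proof (intro conjI ballI)
      show "vec.subspace U"
        using sub by (auto simp: U_def vec.subspace_def vec.add vec.scale)
      fix w assume w: "w \<in> U"
      then have wW: "w \<in> W" "A *v w \<in> W" "As *v w \<in> W"
        using inv by (auto simp: U_def invariant_subspace_def)
      show "As *v w \<in> U" using w wW by (simp add: U_def dual.E_A)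
      have "Es j *v (A *v w) = 0" if j: "k \<le> j" for j
      proof (cases "j = k")
        case True
        then show ?thesis using Es_k wW by blast
      next
        case False
        have "Es j *v (A *v (Es i *v w)) = 0" for i
          using w j False tridiagonal[of j i w] by (cases "k \<le> i") (auto simp: U_def)
        then have "Es j *v (A *v (\<Sum>i\<le>D. Es i *v w)) = 0" by (simp add: vec.sum)
        then show ?thesis by (simp add: dual.E_sum)
      qed
      then show "A *v w \<in> U" using wW by (simp add: U_def)
    qed
    moreover have "U \<subseteq> W" by (auto simp: U_def)
    ultimately have "U = {0} \<or> U = W" using irr by (simp add: irreducible_subspace_def)
    then show False
    proof
      assume "U = W"
      then show False using ends(2) k by (auto simp: U_def support_def acts_nonzero_def)
    next
      assume U: "U = {0}"
      obtain w where w: "w \<in> W" "Es rho *v w \<noteq> 0"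
        using ends by (auto simp: support_def acts_nonzero_def)
      have "rho \<noteq> k" using ends k by auto
      then have "Es rho *v w \<in> U"
        using w k E_mem(2)[OF inv] by (auto simp: U_def dual.E_E)
      with U w show False by simp
    qed
  qed
qed

lemma endpoint_bound: "D \<le> 2 * rho + (tau' - tau)"
proof (rule ccontr)
  assume neg: "\<not> D \<le> 2 * rho + (tau' - tau)"
  have "rho \<in> support Es W"
    using dual.finite_support dual.support_nonempty sub nonzero Min_in by blast
  then obtain v where v: "v \<in> W" "Es rho *v v \<noteq> 0" by (auto simp: support_def acts_nonzero_def)
  define w where "w = Es rho *v v"
  have w: "w \<in> W" "w \<noteq> 0" "Es rho *v w = w"
    using v E_mem(2)[OF inv] by (auto simp: w_def dual.E_E)
  \<comment> \<open>\<open>w\<close> has components at no more than \<open>e\<close> consecutive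
    indices. By \<open>neg\<close>, \<open>e\<close> is at most \<open>D\<close> and
    \<open>Suc (D - e)\<close>, which is \<open>D - (tau' - tau)\<close>, exceeds
    \<open>2 * rho\<close>.\<close>
  define e where "e = Suc (tau' - tau)"
  have "tau \<le> k \<and> k < tau + e" if "E k *v w \<noteq> 0" for k
    using that E_eq_0_outside_support[OF w(1), of k] by (force simp: e_def)
  then have "w \<in> vec.span ((\<lambda>h. F h *v w) ` {Suc (D - e)..D})"
    using neg by (intro mem_span_high_F[of w tau e]) (auto simp: e_def)
  then have "herm w w = 0"
  proof (rule vec.span_induct[where P = "\<lambda>x. herm w x = 0"])
    fix x assume "x \<in> (\<lambda>h. F h *v w) ` {Suc (D - e)..D}"
    then obtain h where h: "x = F h *v w" "2 * rho < h" using neg by (auto simp: e_def)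
    have "herm w x = herm w (Es rho *v (F h *v (Es rho *v w)))"
      using w(3) h dual.E_herm[of rho w "F h *v w"] by simp
    then show "herm w x = 0" using h by (simp add: F_vanish)
  qed (rule subspace_herm_orthogonal_right)
  with w show False by (simp add: herm_self_eq_0_iff)
qed

lemma displacement_nonneg: "D \<le> rho' + tau"
proof -
  interpret sw: irreducible_module D As Es ths E Fs qs A th F q W by (rule swapped_module)
  have "rho \<le> rho'" "tau \<le> tau'"
    using finite_support dual.finite_support support_nonempty dual.support_nonempty sub nonzero
    by (simp_all add: Min_in)
  then show ?thesis
    using endpoint_bound sw.endpoint_bound diameters_eq by linarith
qed

text \<open>Write \<open>w\<close> as a sum of vectors \<open>u a\<close> from the corners on the
  level \<open>s\<close>. Those with \<open>a > i\<close> or \<open>s - a > j\<close> vanish. As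
  \<open>s < i + j\<close>, the term \<open>u i\<close> lies in the corner \<open>(i, j - 1)\<close>
  and the remaining ones lie in \<open>(i - 1, j)\<close>. The conditional conclusions avoid the
  index -1.\<close>

lemma corner_split:
  assumes w: "w \<in> corner Es E W i j" and ij: "rho' + tau < i + j"
  obtains w1 w2 where "w = w1 + w2" "j = 0 \<Longrightarrow> w1 = 0" "0 < j \<Longrightarrow> w1 \<in> corner Es E W i (j - 1)"
    "i = 0 \<Longrightarrow> w2 = 0" "0 < i \<Longrightarrow> w2 \<in> corner Es E W (i - 1) j"
proof -
  let ?s = "rho' + tau"
  have "w \<in> vec.span (\<Union>a\<le>?s. corner Es E W a (?s - a))"
    using w unfolding corner_sum_eq by (simp add: corner_def)
  then obtain u where u: "\<And>a. u a \<in> corner Es E W a (?s - a)" "w = (\<Sum>a\<le>?s. u a)"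
    by (rule span_UN_subspaces_decompose[where S = "\<lambda>a. corner Es E W a (?s - a)", OF subspace_corner[OF sub]]) blast
  \<comment> \<open>From the largest \<open>a\<close> down: \<open>Es a\<close> annihilates
    \<open>w\<close> and all other terms, hence also \<open>u a\<close>, which therefore lies in a
    corner below the level.\<close>
  have high: "u a = 0" if "i < a" "a \<le> ?s" for a
    using that
  proof (induction "?s - a" arbitrary: a rule: less_induct)
    case less
    have "u a \<in> corner Es E W (a - 1) (?s - a)"
    proof -
      have "Es k *v u a = 0" if "k > a - 1" for k
      proof (cases "k = a")
        case True
        have "0 = Es a *v w" using w less.prems by (simp add: corner_def)
        also have "\<dots> = (\<Sum>b\<le>?s. Es a *v u b)" by (simp add: u(2) vec.sum)
        also have "\<dots> = (\<Sum>b\<le>?s. if b = a then Es a *v u a else 0)"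
        proof (intro sum.cong refl)
          fix b assume b: "b \<in> {..?s}"
          consider "b < a" | "b = a" | "a < b" by linarith
          then show "Es a *v u b = (if b = a then Es a *v u a else 0)"
          proof cases
            case 1
            then show ?thesis using u(1)[of b] by (simp add: corner_def)
          next
            case 3
            then have "u b = 0" using less b by simp
            then show ?thesis using 3 by simp
          qed simp
        qed
        finally show ?thesis using True less.prems by simp
      qed (use u(1)[of a] that in \<open>auto simp: corner_def\<close>)
      then show ?thesis using u(1)[of a] by (auto simp: corner_def)
    qed
    moreover have "a - 1 + (?s - a) < ?s" using less.prems by linarith
    ultimately show ?case using corner_eq_0 by blast
  qed
  \<comment> \<open>Symmetrically with \<open>E\<close>, from the smallest \<open>a\<close>
    up.\<close>
  have low: "u a = 0" if "a + j < ?s" for a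
    using that
  proof (induction a rule: less_induct)
    case (less a)
    have "u a \<in> corner Es E W a (?s - a - 1)"
    proof -
      have "E k *v u a = 0" if "k > ?s - a - 1" for k
      proof (cases "k = ?s - a")
        case True
        have "0 = E k *v w" using w less.prems True by (simp add: corner_def)
        also have "\<dots> = (\<Sum>b\<le>?s. E k *v u b)" by (simp add: u(2) vec.sum)
        also have "\<dots> = (\<Sum>b\<le>?s. if b = a then E k *v u a else 0)"
        proof (intro sum.cong refl)
          fix b assume b: "b \<in> {..?s}"
          consider "b < a" | "b = a" | "a < b" by linarith
          then show "E k *v u b = (if b = a then E k *v u a else 0)"
          proof cases
            case 1
            then have "u b = 0" using less by simp
            then show ?thesis using 1 by simp
          next
            case 3
            then have "?s - b < k" using True b by simp
            then show ?thesis using u(1)[of b] 3 by (simp add: corner_def)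
          qed simp
        qed
        finally show ?thesis using less.prems by simp
      qed (use u(1)[of a] that in \<open>auto simp: corner_def\<close>)
      then show ?thesis using u(1)[of a] by (auto simp: corner_def)
    qed
    moreover have "a + (?s - a - 1) < ?s" using less.prems by linarith
    ultimately show ?case using corner_eq_0 by blast
  qed
  \<comment> \<open>If \<open>i\<close> exceeds the level, the sum has no term \<open>u i\<close>
    and everything goes into \<open>w2\<close>.\<close>
  define w1 where "w1 = (if i \<le> ?s then u i else 0)"
  define w2 where "w2 = (\<Sum>a\<in>{..?s} - {i}. u a)"
  have "w = w1 + w2"
  proof (cases "i \<le> ?s")
    case True
    then show ?thesis unfolding u(2) w1_def w2_def by (subst sum.remove[of _ i]) auto
  next
    case False
    then have "{..?s} - {i} = {..?s}" by auto
    with False show ?thesis by (simp add: u(2) w1_def w2_def)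
  qed
  moreover have "w1 = 0" if "j = 0" using ij that by (simp add: w1_def)
  moreover have "w1 \<in> corner Es E W i (j - 1)" if "0 < j"
  proof -
    have "u i \<in> corner Es E W i (j - 1)"
      by (rule subsetD[OF corner_mono u(1)[of i]]) (use ij that in auto)
    moreover have "0 \<in> corner Es E W i (j - 1)"
      using subspace_corner[OF sub] vec.subspace_0 by blast
    ultimately show ?thesis by (simp add: w1_def)
  qed
  moreover have "w2 = 0" if "i = 0"
    using that high by (auto simp: w2_def intro!: sum.neutral)
  moreover have "w2 \<in> corner Es E W (i - 1) j" if i: "0 < i"
    unfolding w2_def
  proof (intro vec.subspace_sum subspace_corner sub)
    fix a assume a: "a \<in> {..?s} - {i}"
    show "u a \<in> corner Es E W (i - 1) j"
    proof (cases "i < a \<or> a + j < ?s")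
      case True
      then have "u a = 0" using a high low by auto
      then show ?thesis using subspace_corner[OF sub] vec.subspace_0 by metis
    next
      case False
      then show ?thesis using a i by (intro subsetD[OF corner_mono u(1)[of a]]) auto
    qed
  qed
  ultimately show thesis using that by blast
qed

end

section \<open>Decomposition of the whole space by level\<close>

lemma invariant_span_Union:
  assumes "\<And>W. W \<in> \<W> \<Longrightarrow> invariant_subspace A As W"
  shows "invariant_subspace A As (vec.span (\<Union>\<W>))"
proof -
  have "B *v w \<in> vec.span (\<Union>\<W>)"
    if "w \<in> vec.span (\<Union>\<W>)" and B: "\<And>W w. W \<in> \<W> \<Longrightarrow> w \<in> W \<Longrightarrow> B *v w \<in> W" for B w
    using that(1)
  proof (rule vec.span_induct)
    show "vec.subspace {w. B *v w \<in> vec.span (\<Union>\<W>)}"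
      by (auto simp: vec.subspace_def vec.add vec.scale vec.span_zero intro: vec.span_add vec.span_scale)
    show "B *v u \<in> vec.span (\<Union>\<W>)" if "u \<in> \<Union>\<W>" for u
      using that B by (auto intro!: vec.span_base)
  qed
  with assms show ?thesis by (auto simp: invariant_subspace_def)
qed

context dual_spectral_pair
begin

text \<open>On an irreducible module the level is \<open>D\<close> plus the displacement.\<close>

definition level :: "'x cvec set \<Rightarrow> nat" where
  "level W = Max (support Es W) + Min (support E W)"

text \<open>The union of the two lower neighbours, where a neighbour with index -1 contributes
  nothing. Orthogonality to their sum is orthogonality to this set, so \<open>split_part\<close> is
  the space \<open>V_tilde\<close>.\<close>

definition lower_corners :: "nat \<Rightarrow> nat \<Rightarrow> 'x cvec set" where
  "lower_corners i j =
     {u. (0 < j \<and> u \<in> corner Es E UNIV i (j - 1)) \<or> (0 < i \<and> u \<in> corner Es E UNIV (i - 1) j)}"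

definition split_part :: "nat \<Rightarrow> nat \<Rightarrow> 'x cvec set" where
  "split_part i j = {v \<in> corner Es E UNIV i j. \<forall>u\<in>lower_corners i j. herm v u = 0}"

lemma irreducible_moduleI:
  "irreducible_subspace A As W \<Longrightarrow> irreducible_module D A E th Es F q As ths Fs qs W"
  by (intro irreducible_module.intro irreducible_module_axioms.intro dual_spectral_pair_axioms)

text \<open>The orthogonal projection of \<open>v\<close> onto \<open>W\<close> lies in the corner
  \<open>(i, j)\<close> of \<open>W\<close>, which is zero below the level.\<close>

lemma low_corner_orthogonal:
  assumes W: "irreducible_subspace A As W" and v: "v \<in> corner Es E UNIV i j"
    and ij: "i + j < level W" and w: "w \<in> W"
  shows "herm v w = 0"
proof -
  interpret irreducible_module D A E th Es F q As ths Fs qs W using W by (rule irreducible_moduleI)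
  obtain y where y: "y \<in> W" "\<And>w. w \<in> W \<Longrightarrow> herm (v - y) w = 0"
    using ex_orthogonal_projection[OF sub] by blast
  have "y \<in> corner Es E W i j" by (rule projection_mem_corner[OF inv v y])
  then have "y = 0" using corner_eq_0 ij by (auto simp: level_def)
  then show ?thesis using y(2)[OF w] by simp
qed

lemma lower_corner_orthogonal:
  assumes W: "irreducible_subspace A As W" and u: "u \<in> lower_corners i j"
    and ij: "i + j \<le> level W" and w: "w \<in> W"
  shows "herm u w = 0"
  using u low_corner_orthogonal[OF W _ _ w, of u i "j - 1"] low_corner_orthogonal[OF W _ _ w, of u "i - 1" j] ij
  by (auto simp: lower_corners_def)

text \<open>By \<open>displacement_nonneg\<close> every irreducible module has level at least
  \<open>D\<close>, so the corner is orthogonal to all of them.\<close>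

lemma corner_eq_0_below_diameter:
  assumes ij: "i + j < D"
  shows "corner Es E UNIV i j = {0}"
proof -
  have "v = 0" if v: "v \<in> corner Es E UNIV i j" for v
  proof (rule eq_0_if_orthogonal_to_irreducibles)
    fix W w assume W: "irreducible_subspace A As W" and w: "w \<in> W"
    interpret irreducible_module D A E th Es F q As ths Fs qs W using W by (rule irreducible_moduleI)
    have "i + j < level W" using displacement_nonneg ij by (simp add: level_def)
    then show "herm v w = 0" using low_corner_orthogonal W v w by blast
  qed
  moreover have "0 \<in> corner Es E UNIV i j" by (simp add: corner_def)
  ultimately show ?thesis by blast
qed

text \<open>\<open>W\<close> is spanned by the corners on its level, and these are orthogonal to the
  lower corners of the whole space, whose index sum is below the level. For a nonzero corner
  \<open>corner_low\<close> and \<open>diameters_eq\<close> bound both indices by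
  \<open>D\<close>.\<close>

lemma irreducible_subset_split_parts:
  assumes W: "irreducible_subspace A As W"
  shows "W \<subseteq> vec.span (\<Union> {split_part i j | i j. i \<le> D \<and> j \<le> D \<and> i + j = level W})"
    (is "_ \<subseteq> vec.span ?S")
proof -
  interpret irreducible_module D A E th Es F q As ths Fs qs W using W by (rule irreducible_moduleI)
  have "u \<in> vec.span ?S" if a: "a \<le> level W" and u: "u \<in> corner Es E W a (level W - a)" for a u
  proof (cases "u = 0")
    case False
    have uW: "u \<in> W" using u by (simp add: corner_def)
    have "rho \<le> a" "tau \<le> level W - a" using corner_low[OF u] False by force+
    moreover have "rho' \<le> D" "tau' \<le> D"
      using finite_support dual.finite_support support_nonempty dual.support_nonempty sub nonzero
        support_le dual.support_le Max_in by blast+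
    ultimately have D: "a \<le> D" "level W - a \<le> D"
      using diameters_eq a by (auto simp: level_def)
    have "herm u v = 0" if "v \<in> lower_corners a (level W - a)" for v
      using lower_corner_orthogonal[OF W that _ uW] a herm_commute[of u v] by simp
    then have "u \<in> split_part a (level W - a)"
      using u by (auto simp: split_part_def corner_def)
    then have "u \<in> ?S" using D a by force
    then show ?thesis by (rule vec.span_base)
  qed (simp add: vec.span_zero)
  then have "(\<Union>a\<le>level W. corner Es E W a (level W - a)) \<subseteq> vec.span ?S" by auto
  then have "vec.span (\<Union>a\<le>level W. corner Es E W a (level W - a)) \<subseteq> vec.span ?S"
    by (intro vec.span_minimal vec.subspace_span)
  then show ?thesis using corner_sum_eq by (simp add: level_def)
qed

text \<open>Subtract from \<open>v\<close> its projection \<open>y\<close> onto the span of the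
  modules of level \<open>i + j\<close>. The rest is orthogonal to every irreducible module: on that
  level by construction, on higher levels by \<open>low_corner_orthogonal\<close>, and on lower
  levels because its projection onto the module splits into vectors of lower corners, to which
  \<open>v - y\<close> is orthogonal.\<close>

lemma split_part_subset_irreducibles:
  "split_part i j \<subseteq> vec.span (\<Union> {W. irreducible_subspace A As W \<and> level W = i + j})"
    (is "_ \<subseteq> ?N")
proof
  fix v assume v: "v \<in> split_part i j"
  have N: "invariant_subspace A As ?N"
    by (rule invariant_span_Union) (auto simp: irreducible_subspace_def)
  obtain y where y: "y \<in> ?N" "\<And>w. w \<in> ?N \<Longrightarrow> herm (v - y) w = 0"
    using ex_orthogonal_projection[OF vec.subspace_span] by blast
  have vc: "v \<in> corner Es E UNIV i j" using v by (simp add: split_part_def)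
  have "y \<in> corner Es E ?N i j" by (rule projection_mem_corner[OF N vc y])
  then have yc: "y \<in> corner Es E UNIV i j" by (simp add: corner_def)
  \<comment> \<open>\<open>v\<close> is orthogonal to the lower corners by definition,
    \<open>y\<close> because it lies in a span of modules of level \<open>i + j\<close>.\<close>
  have "herm u y = 0" if u: "u \<in> lower_corners i j" for u
    using y(1)
    by (rule vec.span_induct) (use lower_corner_orthogonal[OF _ u] in \<open>auto simp: subspace_herm_orthogonal_right\<close>)
  then have low: "herm (v - y) u = 0" if "u \<in> lower_corners i j" for u
    using v that herm_commute[of y u] by (simp add: split_part_def herm_diff_left)
  have vyc: "v - y \<in> corner Es E UNIV i j"
    using vc yc by (intro vec.subspace_diff subspace_corner) auto
  have "v - y = 0"
  proof (rule eq_0_if_orthogonal_to_irreducibles)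
    fix W w assume W: "irreducible_subspace A As W" and w: "w \<in> W"
    interpret irreducible_module D A E th Es F q As ths Fs qs W using W by (rule irreducible_moduleI)
    consider "level W = i + j" | "i + j < level W" | "level W < i + j" by linarith
    then show "herm (v - y) w = 0"
    proof cases
      case 1
      then have "w \<in> ?N" using W w by (intro vec.span_base) auto
      then show ?thesis by (rule y(2))
    next
      case 2
      then show ?thesis using low_corner_orthogonal[OF W vyc _ w] by simp
    next
      case 3
      obtain z where z: "z \<in> W" "\<And>w. w \<in> W \<Longrightarrow> herm (v - y - z) w = 0"
        using ex_orthogonal_projection[OF sub] by blast
      have zc: "z \<in> corner Es E W i j" by (rule projection_mem_corner[OF inv vyc z])
      obtain w1 w2 where "z = w1 + w2" "j = 0 \<Longrightarrow> w1 = 0" "0 < j \<Longrightarrow> w1 \<in> corner Es E W i (j - 1)"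
        "i = 0 \<Longrightarrow> w2 = 0" "0 < i \<Longrightarrow> w2 \<in> corner Es E W (i - 1) j"
        using corner_split[OF zc] 3 by (auto simp: level_def)
      then have "z = w1 + w2" "w1 = 0 \<or> w1 \<in> lower_corners i j" "w2 = 0 \<or> w2 \<in> lower_corners i j"
        by (auto simp: lower_corners_def corner_def)
      then have "herm (v - y) z = 0" using low by (auto simp: herm_add_right)
      then have "herm z z = 0" using z(2)[OF z(1)] by (simp add: herm_diff_left)
      then show ?thesis using z(2)[OF w] by (simp add: herm_self_eq_0_iff)
    qed
  qed
  then show "v \<in> ?N" using y(1) by simp
qed

theorem span_irreducibles_eq_span_split_parts:
  "vec.span (\<Union> {W. irreducible_subspace A As W \<and> level W = n}) =
   vec.span (\<Union> {split_part i j | i j. i \<le> D \<and> j \<le> D \<and> i + j = n})" (is "?L = ?R")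
proof
  show "?L \<subseteq> ?R"
    using irreducible_subset_split_parts by (intro vec.span_minimal) auto
  show "?R \<subseteq> ?L"
    using split_part_subset_irreducibles by (intro vec.span_minimal) auto
qed

end

section \<open>The Bose-Mesner algebra\<close>

lemma msc_nth [simp]: "msc c M $ y $ z = c * M $ y $ z"
  by (simp add: msc_def)

lemma msc_vec: "msc c M *v v = c *s (M *v v)"
  by (simp add: vec_eq_iff matrix_vector_mult_def sum_distrib_left mult.assoc)

lemma msc_mult_left: "msc c M ** N = msc c (M ** N)"
  by (simp add: vec_eq_iff matrix_matrix_mult_def sum_distrib_left mult.assoc)

lemma mult_nth: "(M ** N) $ y $ z = (\<Sum>w\<in>UNIV. M $ y $ w * N $ w $ z)" for M :: "'x::finite cmat"
  by (simp add: matrix_matrix_mult_def)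

lemma mult_vec_nth: "(M *v v) $ y = (\<Sum>z\<in>UNIV. M $ y $ z * v $ z)" for M :: "'x::finite cmat"
  by (simp add: matrix_vector_mult_def)

lemma sum_mult_left: "(\<Sum>i\<in>I. M i) ** N = (\<Sum>i\<in>I. M i ** N)" for M :: "'i \<Rightarrow> 'x::finite cmat"
  by (induction I rule: infinite_finite_induct)
     (simp_all add: vec_eq_iff mult_nth distrib_right sum.distrib)

lemma sum_mult_vec: "(\<Sum>i\<in>I. M i) *v v = (\<Sum>i\<in>I. M i *v v)" for M :: "'i \<Rightarrow> 'x::finite cmat"
  by (induction I rule: infinite_finite_induct) (simp_all add: matrix_vector_mult_add_rdistrib)

lemma msc_eq_0_iff: "msc c M = 0 \<longleftrightarrow> c = 0 \<or> M = 0"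
  by (auto simp: vec_eq_iff)

lemma msc_1 [simp]: "msc 1 M = M"
  by (simp add: vec_eq_iff)

lemma sum_entry_square_eq_0:
  fixes M :: "'x::finite cmat"
  assumes "(\<Sum>y\<in>UNIV. \<Sum>z\<in>UNIV. M $ y $ z * cnj (M $ y $ z)) = 0"
  shows "M = 0"
proof -
  have "complex_of_real (\<Sum>y\<in>UNIV. \<Sum>z\<in>UNIV. (cmod (M $ y $ z))\<^sup>2) = 0"
    using assms by (simp add: complex_norm_square del: of_real_power)
  then have "(\<Sum>y\<in>UNIV. \<Sum>z\<in>UNIV. (cmod (M $ y $ z))\<^sup>2) = 0" by (simp only: of_real_eq_0_iff)
  then show ?thesis
    by (simp add: sum_nonneg_eq_0_iff sum_nonneg vec_eq_iff)
qed

text \<open>In the recurrence the coefficient of \<open>F (l + 1)\<close> is nonzero and all later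
  ones vanish, so \<open>F (l + 1)\<close> can be solved for. Serves both the distance matrices
  under \<open>A\<close> and the idempotents under the entrywise product with
  \<open>E 1\<close>.\<close>

lemma three_term_closed:
  fixes F :: "nat \<Rightarrow> 'x::finite cmat"
  assumes add: "\<And>Y Z. P Y \<Longrightarrow> P Z \<Longrightarrow> P (Y + Z)" and scale: "\<And>c Y. P Y \<Longrightarrow> P (msc c Y)"
    and start: "P (F 0)"
    and step: "\<And>l. l < D \<Longrightarrow> P (F l) \<Longrightarrow> P (\<Sum>h\<le>D. msc (c l h) (F h))"
    and high: "\<And>l h. l < D \<Longrightarrow> h \<le> D \<Longrightarrow> l + 1 < h \<Longrightarrow> c l h = 0"
    and lead: "\<And>l. l < D \<Longrightarrow> c l (l + 1) \<noteq> 0"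
    and l: "l \<le> D"
  shows "P (F l)"
  using l
proof (induction l rule: less_induct)
  case (less l)
  show ?case
  proof (cases l)
    case 0
    then show ?thesis using start by simp
  next
    case (Suc m)
    with less have m: "m < D" "\<And>h. h \<le> m \<Longrightarrow> P (F h)" by auto
    have "P (msc 0 (F 0))" by (intro scale start)
    moreover have "msc 0 (F 0) = 0" by (simp add: vec_eq_iff)
    ultimately have P0: "P 0" by simp
    have P_sum: "P (sum f I)" if "finite I" "\<And>h. h \<in> I \<Longrightarrow> P (f h)" for f and I :: "nat set"
      using that by (induction I rule: finite_induct) (auto intro: add P0)
    have "(\<Sum>h\<le>D. msc (c m h) (F h)) = (\<Sum>h\<le>Suc m. msc (c m h) (F h))"
      using m high by (intro sum.mono_neutral_right) (auto simp: vec_eq_iff)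
    then have eq: "msc (c m (Suc m)) (F (Suc m))
        = (\<Sum>h\<le>D. msc (c m h) (F h)) + msc (-1) (\<Sum>h\<le>m. msc (c m h) (F h))"
      by (simp add: vec_eq_iff)
    have "P (\<Sum>h\<le>D. msc (c m h) (F h))" using step m by simp
    moreover have "P (\<Sum>h\<le>m. msc (c m h) (F h))" using m by (intro P_sum scale) auto
    ultimately have "P (msc (c m (Suc m)) (F (Suc m)))" unfolding eq by (intro add scale)
    then have "P (msc (1 / c m (Suc m)) (msc (c m (Suc m)) (F (Suc m))))" by (rule scale)
    moreover have "msc (1 / c m (Suc m)) (msc (c m (Suc m)) (F (Suc m))) = F (Suc m)"
      using lead[OF m(1)] by (simp add: vec_eq_iff)
    ultimately show ?thesis using Suc by simp
  qed
qed

section \<open>Distances and intersection numbers of a distance-regular graph\<close>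

locale distance_regular_graph =
  fixes adj :: "'x::finite \<Rightarrow> 'x \<Rightarrow> bool" and x :: 'x
  assumes regular: "distance_regular adj"
begin

abbreviation "dist' \<equiv> gdist adj"
abbreviation "D \<equiv> diameter adj"

lemma adj_sym: "adj y z \<Longrightarrow> adj z y" and adj_irrefl: "\<not> adj y y"
  using regular by (auto simp: distance_regular_def simple_graph_def)

lemma relpowp_gdist: "(adj ^^ dist' y z) y z"
proof -
  have "\<exists>n. (adj ^^ n) y z"
    using regular by (auto simp: distance_regular_def connected_graph_def)
  then show ?thesis unfolding gdist_def by (rule LeastI_ex)
qed

lemma gdist_le: "(adj ^^ n) y z \<Longrightarrow> dist' y z \<le> n"
  unfolding gdist_def by (rule Least_le)

lemma gdist_commute: "dist' y z = dist' z y"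
proof -
  have "(adj ^^ n) y z \<Longrightarrow> (adj ^^ n) z y" for n y z
  proof (induction n arbitrary: y z)
    case (Suc n)
    then obtain w where "(adj ^^ n) y w" "adj w z" by auto
    then show ?case using Suc.IH adj_sym relpowp_Suc_I2 by metis
  qed simp
  then have "dist' z y \<le> dist' y z" for y z
    using relpowp_gdist gdist_le by blast
  then show ?thesis by (simp add: order_antisym)
qed

lemma gdist_triangle: "dist' y w \<le> dist' y z + dist' z w"
proof (rule gdist_le)
  show "(adj ^^ (dist' y z + dist' z w)) y w"
    unfolding relpowp_add using relpowp_gdist by (rule relcomppI) (rule relpowp_gdist)
qed

lemma gdist_eq_0_iff: "dist' y z = 0 \<longleftrightarrow> y = z"
proof
  assume "dist' y z = 0"
  then show "y = z" using relpowp_gdist[of y z] by simp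
next
  assume "y = z"
  then have "(adj ^^ 0) y z" by simp
  then have "dist' y z \<le> 0" by (rule gdist_le)
  then show "dist' y z = 0" by simp
qed

lemma gdist_self [simp]: "dist' y y = 0"
  by (simp add: gdist_eq_0_iff)

lemma gdist_eq_1_iff: "dist' y z = 1 \<longleftrightarrow> adj y z"
proof
  assume "dist' y z = 1"
  then show "adj y z" using relpowp_gdist[of y z] by (simp add: eq_OO)
next
  assume a: "adj y z"
  then have "(adj ^^ 1) y z" by (simp add: eq_OO)
  then have "dist' y z \<le> 1" using gdist_le by blast
  moreover have "dist' y z \<noteq> 0" using a adj_irrefl[of y] gdist_eq_0_iff[of y z] by metis
  ultimately show "dist' y z = 1" by simp
qed

lemma ex_closer_neighbour:
  assumes "dist' y z = Suc n"
  obtains w where "adj y w" "dist' w z = n"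
proof -
  have "(adj ^^ Suc n) y z" using relpowp_gdist[of y z] assms by simp
  then obtain w where w: "adj y w" "(adj ^^ n) w z" by (rule relpowp_Suc_E2)
  moreover have "dist' w z = n"
  proof -
    have "dist' y w = 1" using w(1) by (simp only: gdist_eq_1_iff)
    then show ?thesis using gdist_le[OF w(2)] gdist_triangle[of y z w] assms by linarith
  qed
  ultimately show thesis using that by blast
qed

lemma gdist_set: "{dist' y z | y z. True} = (\<lambda>(y, z). dist' y z) ` UNIV"
  by auto

lemma gdist_le_diameter: "dist' y z \<le> D"
proof -
  have "finite {dist' y z | y z. True}" unfolding gdist_set by simp
  then show ?thesis unfolding diameter_def by (rule Max_ge) blast
qed

lemma ex_gdist_eq:
  assumes "l \<le> D"
  shows "\<exists>y z. dist' y z = l"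
  using assms
proof (induction l rule: inc_induct)
  case base
  have "D \<in> {dist' y z | y z. True}"
    unfolding diameter_def gdist_set by (rule Max_in) auto
  then show ?case by force
next
  case (step l)
  then obtain y z where "dist' y z = Suc l" by blast
  then show ?case using ex_closer_neighbour by metis
qed

lemma card_sphere_inter:
  "dist' y z = dist' y' z' \<Longrightarrow> card {w. dist' y w = i \<and> dist' z w = j} = card {w. dist' y' w = i \<and> dist' z' w = j}"
  using regular unfolding distance_regular_def by blast

text \<open>For two equal vertices distance-regularity says that spheres of a given radius have the
  same size everywhere, and some sphere of radius \<open>l\<close> is nonempty.\<close>

lemma ex_gdist_from:
  assumes "l \<le> D"
  shows "\<exists>w. dist' y w = l"
proof -
  obtain u v where uv: "dist' u v = l" using ex_gdist_eq assms by blast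
  have "card {w. dist' y w = l \<and> dist' y w = l} = card {w. dist' u w = l \<and> dist' u w = l}"
    by (rule card_sphere_inter) simp
  moreover have "card {w. dist' u w = l \<and> dist' u w = l} \<noteq> 0" using uv by auto
  ultimately have "{w. dist' y w = l \<and> dist' y w = l} \<noteq> {}" by force
  then show ?thesis by blast
qed

definition vertex_at :: "nat \<Rightarrow> 'x" where
  "vertex_at h = (SOME w. dist' x w = h)"

definition val :: "'x cmat \<Rightarrow> nat \<Rightarrow> complex" where
  "val Y h = Y $ x $ vertex_at h"

text \<open>The Bose-Mesner algebra, described without coefficients to make closure properties easy
  (see \<open>bose_mesner_eq_BM\<close>). For a member \<open>Y\<close>, \<open>val Y h\<close> is
  its entry at distance \<open>h\<close>.\<close>

definition BM :: "'x cmat set" where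
  "BM = {Y. \<forall>y z y' z'. dist' y z = dist' y' z' \<longrightarrow> Y $ y $ z = Y $ y' $ z'}"

lemma gdist_vertex_at: "h \<le> D \<Longrightarrow> dist' x (vertex_at h) = h"
  unfolding vertex_at_def by (rule someI_ex[OF ex_gdist_from])

lemma BM_nth:
  assumes "Y \<in> BM"
  shows "Y $ y $ z = val Y (dist' y z)"
proof -
  have "dist' y z = dist' x (vertex_at (dist' y z))"
    using gdist_vertex_at[OF gdist_le_diameter] by simp
  then show ?thesis using assms unfolding BM_def val_def by blast
qed

lemma BM_sym:
  assumes "Y \<in> BM"
  shows "Y $ y $ z = Y $ z $ y"
  unfolding BM_nth[OF assms] by (rule arg_cong[OF gdist_commute])

lemma BM_expand:
  assumes "Y \<in> BM"
  shows "Y = (\<Sum>h\<le>D. msc (val Y h) (dist_mat adj h))"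
proof -
  have "(\<Sum>h\<le>D. msc (val Y h) (dist_mat adj h)) $ y $ z = Y $ y $ z" for y z
  proof -
    have "(\<Sum>h\<le>D. msc (val Y h) (dist_mat adj h)) $ y $ z
        = (\<Sum>h\<le>D. if h = dist' y z then val Y (dist' y z) else 0)"
      unfolding sum_component by (intro sum.cong) (auto simp: dist_mat_def)
    also have "\<dots> = val Y (dist' y z)" using gdist_le_diameter[of y z] by simp
    finally show ?thesis by (simp only: BM_nth[OF assms])
  qed
  then have "(\<Sum>h\<le>D. msc (val Y h) (dist_mat adj h)) = Y" unfolding vec_eq_iff by blast
  then show ?thesis by (rule sym)
qed

lemma BM_I:
  assumes "\<And>y z. Y $ y $ z = f (dist' y z)"
  shows "Y \<in> BM"
  unfolding BM_def
proof (intro CollectI allI impI)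
  fix y z y' z' assume "dist' y z = dist' y' z'"
  then show "Y $ y $ z = Y $ y' $ z'" unfolding assms by (rule arg_cong)
qed

lemma BM_sum:
  assumes "\<And>i. i \<in> I \<Longrightarrow> M i \<in> BM"
  shows "(\<Sum>i\<in>I. M i) \<in> BM"
proof (rule BM_I)
  show "(\<Sum>i\<in>I. M i) $ y $ z = (\<Sum>i\<in>I. val (M i) (dist' y z))" for y z
    unfolding sum_component by (intro sum.cong refl BM_nth assms)
qed

lemma BM_msc:
  assumes "Y \<in> BM"
  shows "msc c Y \<in> BM"
  by (rule BM_I[of _ "\<lambda>h. c * val Y h"]) (simp add: BM_nth[OF assms])

lemma BM_one: "mat 1 \<in> BM"
  by (rule BM_I[of _ "\<lambda>h. if h = 0 then 1 else 0"]) (simp add: mat_def gdist_eq_0_iff)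

lemma BM_dist_mat: "dist_mat adj l \<in> BM"
  by (rule BM_I[of _ "\<lambda>h. if h = l then 1 else 0"]) (simp add: dist_mat_def)

lemma BM_adj_mat: "adj_mat adj \<in> BM"
  by (rule BM_I[of _ "\<lambda>h. if h = 1 then 1 else 0"]) (simp only: adj_mat_def gdist_eq_1_iff vec_lambda_beta)

lemma bose_mesner_eq_BM: "bose_mesner adj = BM"
proof
  show "bose_mesner adj \<subseteq> BM" by (auto simp: bose_mesner_def intro!: BM_sum BM_msc BM_dist_mat)
  show "BM \<subseteq> bose_mesner adj"
  proof
    fix Y assume "Y \<in> BM"
    from BM_expand[OF this] show "Y \<in> bose_mesner adj"
      unfolding bose_mesner_def by (intro CollectI exI conjI TrueI)
  qed
qed

text \<open>Grouping the sum over \<open>w\<close> by its two distances turns each entry into a sum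
  weighted by intersection numbers, which depend only on the distance of the two outer
  vertices.\<close>

lemma BM_mult:
  assumes Y: "Y \<in> BM" and Z: "Z \<in> BM"
  shows "Y ** Z \<in> BM"
proof -
  have "(Y ** Z) $ y $ z = (\<Sum>(i, j)\<in>{..D} \<times> {..D}.
      of_nat (card {w. dist' y w = i \<and> dist' z w = j}) * (val Y i * val Z j))" for y z
  proof -
    have "(Y ** Z) $ y $ z = (\<Sum>w\<in>UNIV. val Y (dist' y w) * val Z (dist' z w))"
      unfolding mult_nth
    proof (intro sum.cong refl)
      show "Y $ y $ w * Z $ w $ z = val Y (dist' y w) * val Z (dist' z w)" for w
        by (simp add: BM_nth[OF Y] BM_nth[OF Z] gdist_commute[of w z])
    qed
    also have "\<dots> = (\<Sum>t\<in>{..D} \<times> {..D}. \<Sum>w\<in>{w \<in> UNIV. (dist' y w, dist' z w) = t}.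
        val Y (dist' y w) * val Z (dist' z w))"
      by (rule sum.group[symmetric]) (auto simp: gdist_le_diameter)
    also have "\<dots> = (\<Sum>(i, j)\<in>{..D} \<times> {..D}.
        of_nat (card {w. dist' y w = i \<and> dist' z w = j}) * (val Y i * val Z j))"
    proof (intro sum.cong refl, clarify)
      fix i j
      have "(\<Sum>w\<in>{w \<in> UNIV. (dist' y w, dist' z w) = (i, j)}. val Y (dist' y w) * val Z (dist' z w))
          = (\<Sum>w\<in>{w. dist' y w = i \<and> dist' z w = j}. val Y i * val Z j)"
        by (intro sum.cong) auto
      then show "(\<Sum>w\<in>{w \<in> UNIV. (dist' y w, dist' z w) = (i, j)}. val Y (dist' y w) * val Z (dist' z w))
          = of_nat (card {w. dist' y w = i \<and> dist' z w = j}) * (val Y i * val Z j)"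
        by simp
    qed
    finally show ?thesis .
  qed
  note entry = this
  show ?thesis
    unfolding BM_def
  proof (intro CollectI allI impI)
    fix y z y' z' assume "dist' y z = dist' y' z'"
    then show "(Y ** Z) $ y $ z = (Y ** Z) $ y' $ z'"
      unfolding entry by (simp only: card_sphere_inter[of y z y' z'])
  qed
qed

text \<open>All members are symmetric, the product included, and the transpose of
  \<open>Y ** Z\<close> is then \<open>Z ** Y\<close>.\<close>

lemma BM_commute:
  assumes Y: "Y \<in> BM" and Z: "Z \<in> BM"
  shows "Y ** Z = Z ** Y"
proof -
  have "(Y ** Z) $ y $ z = (Z ** Y) $ y $ z" for y z
    using BM_sym[OF BM_mult[OF Y Z], of y z] BM_sym[OF Y] BM_sym[OF Z]
    by (simp add: mult_nth mult.commute)
  then show ?thesis by (simp add: vec_eq_iff)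
qed

lemma BM_eq_0_if_row_eq_0:
  assumes "Y \<in> BM" "Y $ x = 0"
  shows "Y = 0"
  using BM_nth[OF assms(1)] assms(2) by (simp add: vec_eq_iff val_def)

lemma BM_eqI:
  assumes "Y \<in> BM" "Z \<in> BM" "Y $ x = Z $ x"
  shows "Y = Z"
proof -
  have "Y $ y $ z = Z $ y $ z" for y z
    using BM_nth[OF assms(1), of y z] BM_nth[OF assms(2), of y z] assms(3) by (simp add: val_def)
  then show ?thesis by (simp add: vec_eq_iff)
qed

lemma adj_dist_mat_nth:
  "(adj_mat adj ** dist_mat adj l) $ y $ z = of_nat (card {w. adj y w \<and> dist' w z = l})"
proof -
  have "(adj_mat adj ** dist_mat adj l) $ y $ z = (\<Sum>w\<in>UNIV. if adj y w \<and> dist' w z = l then 1 else 0)"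
    unfolding mult_nth by (intro sum.cong) (auto simp: adj_mat_def dist_mat_def)
  then show ?thesis by (simp add: sum.If_cases)
qed

text \<open>The intersection number \<open>p^h_{1l}\<close>, in the index order that
  \<open>spectral_half\<close> expects.\<close>

definition inter_num where "inter_num l h = val (adj_mat adj ** dist_mat adj l) h"

lemma adj_dist_mat: "adj_mat adj ** dist_mat adj l = (\<Sum>h\<le>D. msc (inter_num l h) (dist_mat adj h))"
  unfolding inter_num_def by (intro BM_expand BM_mult BM_adj_mat BM_dist_mat)

lemma inter_num_eq:
  assumes "dist' y z = h"
  shows "inter_num l h = of_nat (card {w. adj y w \<and> dist' w z = l})"
  using BM_nth[OF BM_mult[OF BM_adj_mat BM_dist_mat], of l y z] assms
  by (simp add: inter_num_def adj_dist_mat_nth)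

lemma inter_num_eq_0:
  assumes "h \<le> D" "h + 1 < l \<or> l + 1 < h"
  shows "inter_num l h = 0"
proof -
  obtain y z where h: "dist' y z = h" using assms ex_gdist_eq by blast
  have "\<not> (adj y w \<and> dist' w z = l)" for w
    using h assms(2) gdist_triangle[of y z w] gdist_triangle[of w z y] gdist_eq_1_iff[of y w]
      gdist_commute[of w y] by auto
  then show ?thesis using inter_num_eq[OF h] by simp
qed

lemma inter_num_up_neq_0:
  assumes "l < D"
  shows "inter_num l (Suc l) \<noteq> 0"
proof -
  obtain y z where h: "dist' y z = Suc l" using assms ex_gdist_eq[of "Suc l"] by auto
  obtain w where "adj y w" "dist' w z = l" using ex_closer_neighbour[OF h] .
  then show ?thesis using inter_num_eq[OF h, of l] by auto
qed

lemma inter_num_down_neq_0: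
  assumes "l < D"
  shows "inter_num (Suc l) l \<noteq> 0"
proof -
  obtain y z where h: "dist' y z = Suc l" using assms ex_gdist_eq[of "Suc l"] by auto
  obtain w where w: "adj y w" "dist' w z = l" using ex_closer_neighbour[OF h] .
  then show ?thesis using inter_num_eq[OF w(2), of "Suc l"] h adj_sym by auto
qed

lemma dist_mat_0: "dist_mat adj 0 = mat 1"
  by (simp add: vec_eq_iff dist_mat_def mat_def gdist_eq_0_iff)

end

section \<open>Primitive idempotents and Krein parameters\<close>

locale Q_polynomial_graph = distance_regular_graph adj x
  for adj :: "'x::finite \<Rightarrow> 'x \<Rightarrow> bool" and x :: 'x +
  fixes E :: "nat \<Rightarrow> 'x cmat" and q :: "nat \<Rightarrow> nat \<Rightarrow> nat \<Rightarrow> complex"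
  assumes D_pos: "1 \<le> diameter adj"
    and ordering: "idempotent_ordering adj E"
    and krein: "\<And>i j. i \<le> diameter adj \<Longrightarrow> j \<le> diameter adj \<Longrightarrow> hadamard (E i) (E j) =
             msc (1 / of_nat CARD('x)) (\<Sum>h\<le>diameter adj. msc (q h i j) (E h))"
    and krein_zero: "\<And>h i j. h \<le> diameter adj \<Longrightarrow> i \<le> diameter adj \<Longrightarrow> j \<le> diameter adj \<Longrightarrow>
             h > i + j \<or> i > h + j \<or> j > h + i \<Longrightarrow> q h i j = 0"
    and krein_nonzero: "\<And>h i j. h \<le> diameter adj \<Longrightarrow> i \<le> diameter adj \<Longrightarrow> j \<le> diameter adj \<Longrightarrow>
             h = i + j \<or> i = h + j \<or> j = h + i \<Longrightarrow> q h i j \<noteq> 0"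
begin

lemma primitive: "i \<le> D \<Longrightarrow> primitive_idempotent adj (E i)"
  using ordering by (auto simp: idempotent_ordering_def bij_betw_def)

lemma E_BM: "i \<le> D \<Longrightarrow> E i \<in> BM"
  and E_idem: "i \<le> D \<Longrightarrow> E i ** E i = E i"
  and E_neq_0: "i \<le> D \<Longrightarrow> E i \<noteq> 0"
  using primitive by (auto simp: primitive_idempotent_def bose_mesner_eq_BM)

lemma E_minimal:
  "i \<le> D \<Longrightarrow> G \<in> BM \<Longrightarrow> G ** G = G \<Longrightarrow> G ** E i = G \<Longrightarrow> G = 0 \<or> G = E i"
  using primitive[of i] unfolding primitive_idempotent_def bose_mesner_eq_BM by blast

lemma E_inj: "i \<le> D \<Longrightarrow> j \<le> D \<Longrightarrow> E i = E j \<Longrightarrow> i = j"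
  using ordering unfolding idempotent_ordering_def bij_betw_def inj_on_def by auto

lemma E_0: "E 0 $ y $ z = 1 / of_nat CARD('x)"
  using ordering by (simp add: idempotent_ordering_def)

text \<open>The product is an idempotent lying under both \<open>E i\<close> and \<open>E j\<close>;
  were it nonzero, minimality would make it equal to both.\<close>

lemma E_orthogonal:
  assumes i: "i \<le> D" and j: "j \<le> D" and ij: "i \<noteq> j"
  shows "E i ** E j = 0"
proof -
  let ?G = "E i ** E j"
  have comm: "E j ** E i = ?G" using BM_commute E_BM i j by blast
  have G: "?G \<in> BM" using BM_mult E_BM i j by blast
  have Gj: "?G ** E j = ?G" using E_idem[OF j] by (simp add: matrix_mul_assoc[symmetric])
  have Gi: "?G ** E i = ?G"
    using E_idem[OF i] by (metis comm matrix_mul_assoc)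
  have GG: "?G ** ?G = ?G" by (metis Gi Gj matrix_mul_assoc)
  show ?thesis using E_minimal[OF i G GG Gi] E_minimal[OF j G GG Gj] E_inj[OF i j] ij by auto
qed

lemma E_mult: "i \<le> D \<Longrightarrow> j \<le> D \<Longrightarrow> E i ** E j = (if i = j then E i else 0)"
  by (simp add: E_idem E_orthogonal)

lemma combination_mult_E:
  assumes "j \<le> D"
  shows "(\<Sum>i\<le>D. msc (c i) (E i)) ** E j = msc (c j) (E j)"
proof -
  have "(\<Sum>i\<le>D. msc (c i) (E i)) ** E j = (\<Sum>i\<le>D. if i = j then msc (c j) (E j) else 0)"
    unfolding sum_mult_left msc_mult_left
    by (intro sum.cong) (use assms in \<open>auto simp: E_mult vec_eq_iff\<close>)
  then show ?thesis using assms by simp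
qed

lemma combination_row: "(\<Sum>i\<le>D. msc (c i) (E i)) $ x = (\<Sum>i\<le>D. c i *s (E i $ x))"
  by (simp add: vec_eq_iff)

text \<open>The row map \<open>Y \<mapsto> Y $ x\<close> is injective on the Bose-Mesner algebra, so the algebra has
  dimension at most \<open>D + 1\<close> and is spanned by its \<open>D + 1\<close> orthogonal idempotents.\<close>

lemma BM_combination:
  assumes Y: "Y \<in> BM"
  obtains c where "Y = (\<Sum>i\<le>D. msc (c i) (E i))"
proof -
  let ?B = "(\<lambda>i. E i $ x) ` {..D}"
  let ?V = "(\<lambda>Y. Y $ x) ` BM"
  have inj: "inj_on (\<lambda>i. E i $ x) {..D}"
    by (rule inj_onI) (metis BM_eqI E_BM E_inj atMost_iff)
  have ind: "vec.independent ?B"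
  proof (rule vec.independent_if_scalars_zero)
    fix f v assume f: "(\<Sum>v\<in>?B. f v *s v) = 0" and v: "v \<in> ?B"
    define c where "c i = f (E i $ x)" for i
    obtain j where j: "j \<le> D" "v = E j $ x" using v by auto
    have "(\<Sum>i\<le>D. msc (c i) (E i)) $ x = 0"
      using f unfolding combination_row by (simp add: sum.reindex[OF inj] c_def)
    moreover have "(\<Sum>i\<le>D. msc (c i) (E i)) \<in> BM" using E_BM by (intro BM_sum BM_msc) auto
    ultimately have "(\<Sum>i\<le>D. msc (c i) (E i)) = 0" by (intro BM_eq_0_if_row_eq_0)
    then have "msc (c j) (E j) = 0" using combination_mult_E[OF j(1), of c] by simp
    then show "f v = 0" using E_neq_0[OF j(1)] j by (simp add: msc_eq_0_iff c_def)
  qed simp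
  have "?V \<subseteq> vec.span ((\<lambda>h. dist_mat adj h $ x) ` {..D})"
  proof clarify
    fix Y assume "Y \<in> BM"
    then have "Y $ x = (\<Sum>h\<le>D. msc (val Y h) (dist_mat adj h)) $ x" using BM_expand by metis
    also have "\<dots> = (\<Sum>h\<le>D. val Y h *s (dist_mat adj h $ x))" by (simp add: vec_eq_iff)
    also have "\<dots> \<in> vec.span ((\<lambda>h. dist_mat adj h $ x) ` {..D})"
      by (intro vec.span_sum vec.span_scale vec.span_base) auto
    finally show "Y $ x \<in> vec.span ((\<lambda>h. dist_mat adj h $ x) ` {..D})" .
  qed
  then have "vec.dim ?V \<le> card ((\<lambda>h. dist_mat adj h $ x) ` {..D})"
    by (intro vec.dim_le_card) auto
  also have "\<dots> \<le> card ?B"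
    using card_image_le[of "{..D}" "\<lambda>h. dist_mat adj h $ x"] by (simp add: card_image[OF inj])
  finally have "vec.dim ?V \<le> card ?B" .
  then have "?V \<subseteq> vec.span ?B"
    using ind E_BM by (intro vec.card_ge_dim_independent) auto
  then have "Y $ x \<in> vec.span ?B" using Y by blast
  then obtain f where "Y $ x = (\<Sum>v\<in>?B. f v *s v)"
    by (auto simp: vec.span_finite)
  then have "Y $ x = (\<Sum>i\<le>D. msc (f (E i $ x)) (E i)) $ x"
    unfolding combination_row by (simp add: sum.reindex[OF inj])
  moreover have "(\<Sum>i\<le>D. msc (f (E i $ x)) (E i)) \<in> BM" using E_BM by (intro BM_sum BM_msc) auto
  ultimately have "Y = (\<Sum>i\<le>D. msc (f (E i $ x)) (E i))" using BM_eqI Y by blast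
  then show thesis by (rule that)
qed

lemma E_sum_one: "(\<Sum>i\<le>D. E i) = mat 1"
proof -
  obtain c where c: "mat 1 = (\<Sum>i\<le>D. msc (c i) (E i))" using BM_combination[OF BM_one] .
  have "c i = 1" if i: "i \<le> D" for i
  proof -
    have "E i = msc (c i) (E i)" using combination_mult_E[OF i, of c] c by (metis matrix_mul_lid)
    moreover have "msc (c i - 1) (E i) = msc (c i) (E i) - E i"
      by (simp add: vec_eq_iff algebra_simps)
    ultimately have "msc (c i - 1) (E i) = 0" by simp
    then show ?thesis using E_neq_0[OF i] by (simp add: msc_eq_0_iff)
  qed
  then show ?thesis unfolding c by (intro sum.cong) auto
qed

text \<open>The conjugate \<open>C\<close> of \<open>E i\<close> is again an idempotent of the
  algebra. The product \<open>C ** E i\<close> is an idempotent under \<open>E i\<close>, nonzero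
  because its diagonal entries are squared row norms, hence equal to \<open>E i\<close>; and it is
  its own conjugate.\<close>

lemma E_real:
  assumes i: "i \<le> D"
  shows "cnj (E i $ y $ z) = E i $ y $ z"
proof -
  define C where "C = (\<chi> y z. cnj (E i $ y $ z))"
  let ?G = "C ** E i"
  have Ei: "E i \<in> BM" by (rule E_BM[OF i])
  have C: "C \<in> BM"
    by (rule BM_I[of _ "\<lambda>h. cnj (val (E i) h)"]) (simp add: C_def BM_nth[OF Ei])
  have "(C ** C) $ y $ z = cnj ((E i ** E i) $ y $ z)" for y z by (simp add: mult_nth C_def)
  then have CC: "C ** C = C" by (simp add: E_idem[OF i]) (simp add: vec_eq_iff C_def)
  have comm: "E i ** C = ?G" by (rule BM_commute[OF Ei C])
  have G: "?G \<in> BM" by (rule BM_mult[OF C Ei])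
  have GE: "?G ** E i = ?G" using E_idem[OF i] by (simp add: matrix_mul_assoc[symmetric])
  have GG: "?G ** ?G = ?G" by (metis CC GE comm matrix_mul_assoc)
  have "?G \<noteq> 0"
  proof
    assume G0: "?G = 0"
    have "(\<Sum>z\<in>UNIV. E i $ y $ z * cnj (E i $ y $ z)) = ?G $ y $ y" for y
      unfolding mult_nth C_def using BM_sym[OF Ei, of _ y] by (simp add: mult.commute)
    then have "E i = 0" using G0 by (intro sum_entry_square_eq_0) simp
    then show False using E_neq_0[OF i] by simp
  qed
  then have G_eq: "?G = E i" using E_minimal[OF i G GG GE] by blast
  have "cnj (?G $ y $ z) = (E i ** C) $ y $ z" for y z by (simp add: mult_nth C_def)
  then show ?thesis by (simp add: comm G_eq)
qed

lemma E_herm: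
  assumes i: "i \<le> D"
  shows "herm (E i *v u) v = herm u (E i *v v)"
proof -
  have "herm (E i *v u) v = (\<Sum>y\<in>UNIV. \<Sum>z\<in>UNIV. E i $ y $ z * u $ z * cnj (v $ y))"
    by (simp add: herm_def matrix_vector_mult_def sum_distrib_right)
  also have "\<dots> = (\<Sum>z\<in>UNIV. \<Sum>y\<in>UNIV. E i $ y $ z * u $ z * cnj (v $ y))" by (rule sum.swap)
  also have "\<dots> = (\<Sum>z\<in>UNIV. \<Sum>y\<in>UNIV. u $ z * (E i $ z $ y * cnj (v $ y)))"
  proof (intro sum.cong refl)
    show "E i $ y $ z * u $ z * cnj (v $ y) = u $ z * (E i $ z $ y * cnj (v $ y))" for y z
      using BM_sym[OF E_BM[OF i], of y z] by simp
  qed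
  also have "\<dots> = herm u (E i *v v)"
    by (simp add: herm_def matrix_vector_mult_def E_real[OF i] sum_distrib_left)
  finally show ?thesis .
qed

text \<open>The dual distance matrices with respect to \<open>x\<close>. They are zero beyond
  \<open>D\<close>, where \<open>E\<close> is unspecified, because some assumptions of
  \<open>spectral_half\<close> range over all indices.\<close>

definition Fs :: "nat \<Rightarrow> 'x cmat" where
  "Fs h = (\<chi> y z. if y = z \<and> h \<le> D then of_nat CARD('x) * E h $ x $ y else 0)"

lemma Fs_vec: "h \<le> D \<Longrightarrow> (Fs h *v v) $ y = of_nat CARD('x) * E h $ x $ y * v $ y"
  by (simp add: Fs_def matrix_vector_mult_def if_distrib[of "\<lambda>c. c * _"] cong: if_cong)

lemma dual_adj_eq: "dual_adj E x = Fs 1"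
  using D_pos by (simp add: dual_adj_def Fs_def del: One_nat_def)

text \<open>The squared norm of \<open>E i ** Fs h ** E j\<close> is a multiple of the Krein parameter
  \<open>q h i j\<close>.\<close>

lemma triple_product_eq_0:
  assumes h: "h \<le> D" and i: "i \<le> D" and j: "j \<le> D" and q0: "q h i j = 0"
  shows "E i ** Fs h ** E j = 0"
proof (rule sum_entry_square_eq_0)
  let ?n = "of_nat CARD('x) :: complex"
  let ?M = "E i ** Fs h ** E j"
  let ?Mt = "E j ** Fs h ** E i"
  define s where "s w = ?n * E h $ x $ w" for w
  have right: "(N ** Fs h) $ y $ w = N $ y $ w * s w" for N :: "'x cmat" and y w
    using h by (simp add: mult_nth Fs_def s_def if_distrib[of "(*) _"] cong: if_cong)
  have M: "?M $ y $ z = (\<Sum>w\<in>UNIV. E i $ y $ w * s w * E j $ w $ z)" for y z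
    by (simp only: mult_nth[of "E i ** Fs h"] right)
  have Mt: "?Mt $ z $ y = (\<Sum>w\<in>UNIV. E j $ z $ w * s w * E i $ w $ y)" for y z
    by (simp only: mult_nth[of "E j ** Fs h"] right)
  have "cnj (?M $ y $ z) = ?Mt $ z $ y" for y z
    unfolding M Mt cnj_sum
  proof (intro sum.cong refl)
    fix w
    show "cnj (E i $ y $ w * s w * E j $ w $ z) = E j $ z $ w * s w * E i $ w $ y"
      using BM_sym[OF E_BM[OF i], of y w] BM_sym[OF E_BM[OF j], of w z]
      by (simp add: s_def E_real i j h mult_ac)
  qed
  then have "(\<Sum>y\<in>UNIV. \<Sum>z\<in>UNIV. ?M $ y $ z * cnj (?M $ y $ z)) = trace (?M ** ?Mt)"
    by (simp add: trace_def mult_nth[of ?M ?Mt])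
  also have "?M ** ?Mt = E i ** (Fs h ** E j ** Fs h ** E i)"
  proof -
    have "?M ** ?Mt = E i ** (Fs h ** (E j ** E j) ** Fs h ** E i)"
      by (simp only: matrix_mul_assoc)
    then show ?thesis by (simp only: E_idem[OF j])
  qed
  also have "trace \<dots> = trace (Fs h ** E j ** Fs h ** E i ** E i)" by (rule trace_mul_sym)
  also have "Fs h ** E j ** Fs h ** E i ** E i = (Fs h ** E j ** Fs h) ** E i"
    by (simp only: matrix_mul_assoc[symmetric] E_idem[OF i])
  \<comment> \<open>With diagonal outer factors and a symmetric \<open>E i\<close>, the trace is a
    weighted sum of the entries of the Hadamard product, to which the Krein expansion
    applies.\<close>
  also have "trace ((Fs h ** E j ** Fs h) ** E i)
      = (\<Sum>w\<in>UNIV. \<Sum>w'\<in>UNIV. s w * s w' * hadamard (E i) (E j) $ w $ w')"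
  proof -
    have left: "(Fs h ** E j) $ w $ w' = s w * E j $ w $ w'" for w w'
      using h by (simp add: mult_nth Fs_def s_def if_distrib[of "\<lambda>c. c * _"] cong: if_cong)
    have "(Fs h ** E j ** Fs h) $ w $ w' = s w * E j $ w $ w' * s w'" for w w'
      by (simp only: right left)
    moreover have "E i $ w' $ w = E i $ w $ w'" for w w' by (rule BM_sym[OF E_BM[OF i]])
    ultimately show ?thesis
      by (simp add: trace_def mult_nth[of "Fs h ** E j ** Fs h"] hadamard_def mult_ac)
  qed
  also have "\<dots> = (\<Sum>w\<in>UNIV. \<Sum>w'\<in>UNIV. \<Sum>k\<le>D. ?n * q k i j * (E h $ x $ w * E k $ w $ w' * E h $ w' $ x))"
  proof (intro sum.cong refl)
    fix w w'
    have "hadamard (E i) (E j) $ w $ w' = (\<Sum>k\<le>D. 1 / ?n * (q k i j * E k $ w $ w'))"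
      by (simp add: krein[OF i j] sum_distrib_left)
    moreover have "E h $ x $ w' = E h $ w' $ x" by (rule BM_sym[OF E_BM[OF h]])
    ultimately show "s w * s w' * hadamard (E i) (E j) $ w $ w'
      = (\<Sum>k\<le>D. ?n * q k i j * (E h $ x $ w * E k $ w $ w' * E h $ w' $ x))"
      by (simp add: s_def sum_distrib_left mult_ac)
  qed
  \<comment> \<open>The weights regroup into entries of \<open>E h ** (E k ** E h)\<close>, so only
    \<open>k = h\<close> survives, with coefficient \<open>q h i j\<close>.\<close>
  also have "\<dots> = (\<Sum>k\<le>D. ?n * q k i j * (E h ** (E k ** E h)) $ x $ x)"
    unfolding mult_nth sum_distrib_left mult.assoc
    by (rule sym, rule trans[OF sum.swap], intro sum.cong refl sum.swap)
  also have "\<dots> = 0"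
  proof (intro sum.neutral ballI)
    fix k assume "k \<in> {..D}"
    then have "E h ** (E k ** E h) = (if k = h then E h else 0)"
      using h by (simp add: E_mult)
    then show "?n * q k i j * (E h ** (E k ** E h)) $ x $ x = 0" using q0 by simp
  qed
  finally show "(\<Sum>y\<in>UNIV. \<Sum>z\<in>UNIV. ?M $ y $ z * cnj (?M $ y $ z)) = 0" .
qed

text \<open>If \<open>th i = th j\<close>, then by the three-term recurrence every distance matrix
  acts by one common scalar on the ranges of \<open>E i\<close> and \<open>E j\<close>, hence so
  does the whole algebra. But \<open>E i\<close> acts as 1 on the first and as 0 on the
  second.\<close>

lemma eigenvalues_distinct:
  assumes th: "adj_mat adj = (\<Sum>i\<le>D. msc (th i) (E i))"
  shows "inj_on th {..D}"
proof (rule inj_onI, rule ccontr)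
  fix i j assume "i \<in> {..D}" "j \<in> {..D}" and eq: "th i = th j" and ij: "i \<noteq> j"
  then have i: "i \<le> D" and j: "j \<le> D" by auto
  define P where "P Y \<longleftrightarrow> (\<exists>c. Y ** E i = msc c (E i) \<and> Y ** E j = msc c (E j))" for Y
  have P_add: "P (Y + Z)" if "P Y" "P Z" for Y Z
  proof -
    obtain c d where "Y ** E i = msc c (E i)" "Y ** E j = msc c (E j)"
      "Z ** E i = msc d (E i)" "Z ** E j = msc d (E j)" using \<open>P Y\<close> \<open>P Z\<close> by (auto simp: P_def)
    then have "(Y + Z) ** E i = msc (c + d) (E i)" "(Y + Z) ** E j = msc (c + d) (E j)"
      by (simp_all add: vec_eq_iff mult_nth distrib_right sum.distrib)
    then show ?thesis by (auto simp: P_def)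
  qed
  have P_scale: "P (msc c Y)" if "P Y" for c Y
  proof -
    obtain d where "Y ** E i = msc d (E i)" "Y ** E j = msc d (E j)" using \<open>P Y\<close> by (auto simp: P_def)
    then have "msc c Y ** E i = msc (c * d) (E i)" "msc c Y ** E j = msc (c * d) (E j)"
      unfolding msc_mult_left by (simp_all add: vec_eq_iff)
    then show ?thesis by (auto simp: P_def)
  qed
  have P_dist: "P (dist_mat adj l)" if "l \<le> D" for l
  proof (rule three_term_closed[of P "dist_mat adj" D inter_num, OF P_add P_scale])
    have "mat 1 ** E i = msc 1 (E i)" "mat 1 ** E j = msc 1 (E j)" by simp_all
    then show "P (dist_mat adj 0)" unfolding dist_mat_0 P_def by blast
    fix l assume "P (dist_mat adj l)"
    then obtain c where c: "dist_mat adj l ** E i = msc c (E i)" "dist_mat adj l ** E j = msc c (E j)"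
      by (auto simp: P_def)
    have "adj_mat adj ** dist_mat adj l ** E k = msc (c * th k) (E k)"
      if "k \<le> D" "dist_mat adj l ** E k = msc c (E k)" for k
    proof -
      have "adj_mat adj ** dist_mat adj l ** E k = msc c (E k) ** adj_mat adj"
        using that BM_commute[OF BM_adj_mat BM_msc[OF E_BM[OF that(1)]]]
        by (simp add: matrix_mul_assoc[symmetric])
      also have "\<dots> = msc c (adj_mat adj ** E k)"
        unfolding msc_mult_left BM_commute[OF BM_adj_mat E_BM[OF that(1)]] ..
      also have "adj_mat adj ** E k = msc (th k) (E k)"
        unfolding th by (rule combination_mult_E[OF that(1)])
      finally show ?thesis by (simp add: vec_eq_iff)
    qed
    from this[OF i c(1)] this[OF j c(2)]
    show "P (\<Sum>h\<le>D. msc (inter_num l h) (dist_mat adj h))"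
      unfolding adj_dist_mat[symmetric] P_def eq by blast
  qed (use that inter_num_eq_0 inter_num_up_neq_0 in auto)
  have "P (msc 0 (dist_mat adj 0))" by (intro P_scale P_dist) simp
  moreover have "msc 0 (dist_mat adj 0) = 0" by (simp add: vec_eq_iff)
  ultimately have P_0: "P 0" by simp
  have "P (\<Sum>h\<in>I. msc (val (E i) h) (dist_mat adj h))" if "finite I" "I \<subseteq> {..D}" for I
    using that by (induction I rule: finite_induct) (auto intro: P_0 P_add P_scale P_dist)
  from this[of "{..D}"] have "P (E i)" using BM_expand[OF E_BM[OF i]] by simp
  then obtain c where c: "E i ** E i = msc c (E i)" "E i ** E j = msc c (E j)" by (auto simp: P_def)
  then have "msc c (E j) = 0" using E_orthogonal[OF i j ij] by simp
  then have "c = 0" using E_neq_0[OF j] by (simp add: msc_eq_0_iff)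
  then have "msc c (E i) = 0" by (simp add: vec_eq_iff)
  then show False using c(1) E_idem[OF i] E_neq_0[OF i] by simp
qed

text \<open>If \<open>E 1\<close> has equal entries at the distances \<open>i\<close> and
  \<open>j\<close>, then so has every \<open>E l\<close>, by the recurrence for the entrywise
  product with \<open>E 1\<close>, and hence the whole algebra. But \<open>dist_mat adj i\<close>
  separates the two distances.\<close>

lemma dual_eigenvalues_distinct: "inj_on (\<lambda>i. of_nat CARD('x) * val (E 1) i) {..D}"
proof (rule inj_onI, rule ccontr)
  fix i j assume "i \<in> {..D}" "j \<in> {..D}" and ij: "i \<noteq> j"
    and eq1: "of_nat CARD('x) * val (E 1) i = of_nat CARD('x) * val (E 1) j"
  then have i: "i \<le> D" and j: "j \<le> D" and eq: "val (E 1) i = val (E 1) j" by auto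
  define P where "P Y \<longleftrightarrow> val Y i = val Y j" for Y
  have P_add: "P (Y + Z)" if "P Y" "P Z" for Y Z using that by (simp add: P_def val_def)
  have P_scale: "P (msc c Y)" if "P Y" for c Y using that by (simp add: P_def val_def)
  have P_E: "P (E l)" if "l \<le> D" for l
  proof (rule three_term_closed[of P E D "\<lambda>l h. q h 1 l", OF P_add P_scale])
    show "P (E 0)" by (simp add: P_def val_def E_0)
    fix l assume l: "l < D" and "P (E l)"
    then have "P (hadamard (E 1) (E l))" using eq by (simp add: P_def val_def hadamard_def)
    then have "P (msc (of_nat CARD('x)) (hadamard (E 1) (E l)))" by (rule P_scale)
    also have "msc (of_nat CARD('x)) (hadamard (E 1) (E l)) = (\<Sum>h\<le>D. msc (q h 1 l) (E h))"
      using krein[of 1 l] D_pos l by (simp add: vec_eq_iff del: One_nat_def)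
    finally show "P (\<Sum>h\<le>D. msc (q h 1 l) (E h))" .
  qed (use that D_pos krein_zero krein_nonzero in auto)
  obtain c where c: "dist_mat adj i = (\<Sum>l\<le>D. msc (c l) (E l))" using BM_combination[OF BM_dist_mat] .
  have "val (dist_mat adj i) i = val (dist_mat adj i) j"
    using P_E unfolding c P_def val_def by simp
  then show False
    using ij gdist_vertex_at[OF i] gdist_vertex_at[OF j] by (simp add: val_def dist_mat_def)
qed

text \<open>\<open>E\<close> is unspecified beyond \<open>D\<close>.\<close>

definition E' :: "nat \<Rightarrow> 'x cmat" where
  "E' i = (if i \<le> D then E i else 0)"

section \<open>The two spectral halves of a Q-polynomial graph\<close>

abbreviation "Es \<equiv> dual_idem adj x"

lemma Es_vec: "(Es i *v v) $ y = (if dist' x y = i then v $ y else 0)"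
proof -
  have "(Es i *v v) $ y = (\<Sum>z\<in>UNIV. if z = y then (if dist' x y = i then v $ y else 0) else 0)"
    unfolding mult_vec_nth by (intro sum.cong) (auto simp: dual_idem_def)
  then show ?thesis by simp
qed

lemma primal_half:
  obtains th where "spectral_half D (adj_mat adj) E' th Es (dist_mat adj) inter_num"
proof -
  obtain th where th: "adj_mat adj = (\<Sum>i\<le>D. msc (th i) (E i))"
    using BM_combination[OF BM_adj_mat] .
  have "spectral_half D (adj_mat adj) E' th Es (dist_mat adj) inter_num"
  proof
    fix i j h l :: nat and u v :: "'x cvec"
    show "herm (E' i *v u) v = herm u (E' i *v v)" by (simp add: E'_def E_herm)
    show "E' i *v (E' j *v v) = (if i = j then E' i *v v else 0)"
      by (simp add: E'_def matrix_vector_mul_assoc E_mult)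
    show "(\<Sum>i\<le>D. E' i *v v) = v"
    proof -
      have "(\<Sum>i\<le>D. E' i *v v) = (\<Sum>i\<le>D. E i) *v v"
        unfolding sum_mult_vec by (intro sum.cong) (auto simp: E'_def)
      then show ?thesis by (simp add: E_sum_one)
    qed
    show "D < i \<Longrightarrow> E' i = 0" by (simp add: E'_def)
    show "adj_mat adj *v (E' i *v v) = th i *s (E' i *v v)"
      using combination_mult_E[of i th] by (simp add: E'_def matrix_vector_mul_assoc th msc_vec)
    show "inj_on th {..D}" by (rule eigenvalues_distinct[OF th])
    show "Es i *v (adj_mat adj *v (Es j *v v)) = 0" if ij: "i + 1 < j \<or> j + 1 < i"
    proof -
      have zero: "adj_mat adj $ y $ z * (Es j *v v) $ z = 0" if y: "dist' x y = i" for y z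
      proof (cases "adj y z \<and> dist' x z = j")
        case True
        then have "dist' y z = 1" "dist' z y = 1" using gdist_eq_1_iff adj_sym by blast+
        then show ?thesis using gdist_triangle[of x z y] gdist_triangle[of x y z] y True ij by linarith
      qed (auto simp: adj_mat_def Es_vec)
      have "(adj_mat adj *v (Es j *v v)) $ y = 0" if "dist' x y = i" for y
        unfolding mult_vec_nth[of "adj_mat adj"] by (intro sum.neutral ballI zero that)
      then show ?thesis by (simp add: vec_eq_iff Es_vec)
    qed
    show "dist_mat adj 0 *v v = v" by (simp add: dist_mat_0)
    show "dist_mat adj l *v (adj_mat adj *v v) = adj_mat adj *v (dist_mat adj l *v v)"
      by (simp only: matrix_vector_mul_assoc BM_commute[OF BM_dist_mat BM_adj_mat])
    show "adj_mat adj *v (dist_mat adj l *v v) = (\<Sum>h\<le>D. inter_num l h *s (dist_mat adj h *v v))"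
      by (simp only: matrix_vector_mul_assoc adj_dist_mat sum_mult_vec msc_vec)
    show "inter_num l h = 0" if "h + 1 < l" "l \<le> D" using that by (intro inter_num_eq_0) auto
    show "inter_num l (l - 1) \<noteq> 0" if "1 \<le> l" "l \<le> D" using that inter_num_down_neq_0[of "l - 1"] by simp
    \<comment> \<open>Two vertices at distance \<open>i\<close> from \<open>x\<close> are at most
      \<open>2 * i\<close> apart.\<close>
    show "Es i *v (dist_mat adj h *v (Es i *v v)) = 0" if h: "2 * i < h"
    proof -
      have zero: "dist_mat adj h $ y $ z * (Es i *v v) $ z = 0" if y: "dist' x y = i" for y z
      proof (cases "dist' y z = h \<and> dist' x z = i")
        case True
        then show ?thesis using gdist_triangle[of y z x] gdist_commute[of x y] y h by linarith
      qed (auto simp: dist_mat_def Es_vec)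
      have "(dist_mat adj h *v (Es i *v v)) $ y = 0" if "dist' x y = i" for y
        unfolding mult_vec_nth[of "dist_mat adj h"] by (intro sum.neutral ballI zero that)
      then show ?thesis by (simp add: vec_eq_iff Es_vec)
    qed
  qed
  then show thesis by (rule that)
qed

text \<open>Vanishing Krein parameters take the place of the triangle inequality, through
  \<open>triple_product_eq_0\<close>. The recurrence for \<open>Fs\<close> is the Krein expansion of
  \<open>hadamard (E 1) (E l)\<close> read along row \<open>x\<close>.\<close>

lemma dual_half:
  "spectral_half D (dual_adj E x) Es (\<lambda>i. of_nat CARD('x) * val (E 1) i) E' Fs (\<lambda>l h. q h 1 l)"
proof
  fix i j h l :: nat and u v :: "'x cvec"
  have E1: "E 1 $ x $ y = val (E 1) (dist' x y)" for y
    using BM_nth[OF E_BM[OF D_pos]] .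
  show "herm (Es i *v u) v = herm u (Es i *v v)"
    by (auto simp: herm_def Es_vec intro: sum.cong)
  show "Es i *v (Es j *v v) = (if i = j then Es i *v v else 0)"
    by (auto simp: vec_eq_iff Es_vec)
  show "(\<Sum>i\<le>D. Es i *v v) = v" by (simp add: vec_eq_iff Es_vec gdist_le_diameter)
  show "Es i = 0" if "D < i"
  proof -
    have "dist' x y \<noteq> i" for y using gdist_le_diameter[of x y] that by simp
    then show ?thesis by (simp add: vec_eq_iff dual_idem_def)
  qed
  show "dual_adj E x *v (Es i *v v) = (of_nat CARD('x) * val (E 1) i) *s (Es i *v v)"
    unfolding dual_adj_eq by (simp add: vec_eq_iff Fs_vec[OF D_pos] Es_vec E1 del: One_nat_def)
  show "inj_on (\<lambda>i. of_nat CARD('x) * val (E 1) i) {..D}" by (rule dual_eigenvalues_distinct)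
  \<comment> \<open>If an index exceeds \<open>D\<close>, the product vanishes because
    \<open>E'\<close> and \<open>Fs\<close> are zero there.\<close>
  have triple: "E' i *v (Fs h *v (E' j *v v)) = 0"
    if "i \<le> D \<Longrightarrow> j \<le> D \<Longrightarrow> h \<le> D \<Longrightarrow> q h i j = 0" for i j h
  proof (cases "i \<le> D \<and> j \<le> D \<and> h \<le> D")
    case True
    then show ?thesis using triple_product_eq_0[of h i j] that
      by (simp add: E'_def matrix_vector_mul_assoc matrix_mul_assoc)
  next
    case False
    have "Fs h = 0" if "\<not> h \<le> D" using that by (simp add: vec_eq_iff Fs_def)
    with False show ?thesis by (auto simp: E'_def)
  qed
  show "E' i *v (dual_adj E x *v (E' j *v v)) = 0" if "i + 1 < j \<or> j + 1 < i"
    unfolding dual_adj_eq using that by (intro triple krein_zero) auto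
  show "Fs 0 *v v = v" by (simp add: vec_eq_iff Fs_vec E_0)
  show "Fs l *v (dual_adj E x *v v) = dual_adj E x *v (Fs l *v v)"
  proof (cases "l \<le> D")
    case True
    then show ?thesis unfolding dual_adj_eq by (simp add: vec_eq_iff Fs_vec D_pos del: One_nat_def)
  next
    case False
    then have "Fs l = 0" by (simp add: vec_eq_iff Fs_def)
    then show ?thesis by simp
  qed
  show "dual_adj E x *v (Fs l *v v) = (\<Sum>h\<le>D. q h 1 l *s (Fs h *v v))" if l: "1 \<le> l" "l \<le> D"
  proof -
    let ?n = "of_nat CARD('x) :: complex"
    have "(dual_adj E x *v (Fs l *v v)) $ y = (\<Sum>h\<le>D. q h 1 l *s (Fs h *v v)) $ y" for y
    proof -
      have "(dual_adj E x *v (Fs l *v v)) $ y = ?n * (?n * hadamard (E 1) (E l) $ x $ y) * v $ y"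
        unfolding dual_adj_eq using l
        by (simp add: Fs_vec D_pos hadamard_def del: One_nat_def)
      also have "?n * hadamard (E 1) (E l) $ x $ y = (\<Sum>h\<le>D. q h 1 l * E h $ x $ y)"
        using krein[OF D_pos l(2)] by simp
      also have "?n * (\<Sum>h\<le>D. q h 1 l * E h $ x $ y) * v $ y
          = (\<Sum>h\<le>D. q h 1 l *s (Fs h *v v)) $ y"
        unfolding sum_component sum_distrib_left sum_distrib_right
        by (intro sum.cong) (simp_all add: Fs_vec)
      finally show ?thesis .
    qed
    then show ?thesis unfolding vec_eq_iff by blast
  qed
  show "q h 1 l = 0" if "h + 1 < l" "l \<le> D" using that D_pos by (intro krein_zero) auto
  show "q (l - 1) 1 l \<noteq> 0" if "1 \<le> l" "l \<le> D" using that D_pos by (intro krein_nonzero) auto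
  show "E' i *v (Fs h *v (E' i *v v)) = 0" if "2 * i < h"
    using that by (intro triple krein_zero) auto
qed

section \<open>Translation to T-modules and the stated subspaces\<close>

lemma T_module_iff: "T_module adj E x W \<longleftrightarrow> invariant_subspace (adj_mat adj) (dual_adj E x) W"
proof
  assume "T_module adj E x W"
  then show "invariant_subspace (adj_mat adj) (dual_adj E x) W"
    by (auto simp: T_module_def T_algebra_def invariant_subspace_def intro: T_alg.gen1 T_alg.gen2)
next
  assume inv: "invariant_subspace (adj_mat adj) (dual_adj E x) W"
  then have W: "vec.subspace W" by (simp add: invariant_subspace_def)
  have "\<forall>w\<in>W. M *v w \<in> W" if "M \<in> T_alg (adj_mat adj) (dual_adj E x)" for M
    using that
  proof (induction rule: T_alg.induct)
    case (add M N)
    then show ?case using W by (auto simp: matrix_vector_mult_add_rdistrib intro: vec.subspace_add)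
  next
    case (smult M c)
    then show ?case using W by (auto simp: msc_vec intro: vec.subspace_scale)
  next
    case (mult M N)
    then show ?case by (simp add: matrix_vector_mul_assoc[symmetric])
  qed (use inv in \<open>auto simp: invariant_subspace_def\<close>)
  then show "T_module adj E x W" using W by (simp add: T_module_def T_algebra_def)
qed

lemma irred_T_module_iff:
  "irred_T_module adj E x W \<longleftrightarrow> irreducible_subspace (adj_mat adj) (dual_adj E x) W"
  by (simp add: irred_T_module_def irreducible_subspace_def T_module_iff)

lemma support_E'_iff: "i \<in> support E' W \<longleftrightarrow> i \<le> D \<and> acts_nonzero (E i) W"
  by (auto simp: support_def E'_def acts_nonzero_def)

lemma displacement_theorem:
  "(\<forall>eta\<le>D. V_disp adj E x eta =
            vec.span (\<Union> {V_tilde adj E x i j | i j. i \<le> D \<and> j \<le> D \<and> i + j = D + eta}))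
       \<and> (\<forall>i\<le>D. \<forall>j\<le>D. i + j < D \<longrightarrow> V_tilde adj E x i j = {0})
       \<and> (\<forall>i\<le>D. \<forall>j\<le>D. i + j < D \<longrightarrow> V_ij adj E x (int i) (int j) = {0})"
proof -
  obtain th where half: "spectral_half D (adj_mat adj) E' th Es (dist_mat adj) inter_num"
    by (rule primal_half)
  interpret S: dual_spectral_pair D "adj_mat adj" E' th Es "dist_mat adj" inter_num
    "dual_adj E x" "\<lambda>i. of_nat CARD('x) * val (E 1) i" Fs "\<lambda>l h. q h 1 l"
    by (intro dual_spectral_pair.intro half dual_half)
  have V_corner: "V_ij adj E x (int i) (int j) = corner Es E' UNIV i j" if "j \<le> D" for i j
  proof -
    have "(\<Union>k\<in>{..j}. range (\<lambda>v. E k *v v)) = (\<Union>k\<in>{..j}. range (\<lambda>v. E' k *v v))"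
      using that by (auto simp: E'_def)
    then show ?thesis
      by (auto simp: V_ij_def corner_def S.span_range_E S.dual.span_range_E)
  qed
  have V_tilde: "V_tilde adj E x i j = S.split_part i j" if j: "j \<le> D" for i j
  proof -
    \<comment> \<open>The index -1 occurs for \<open>j = 0\<close>, where the space is
      \<open>{0}\<close> by convention.\<close>
    have 1: "V_ij adj E x (int i) (int j - 1) = (if j = 0 then {0} else corner Es E' UNIV i (j - 1))"
      using V_corner[of "j - 1" i] j by (cases j) (auto simp: V_ij_def)
    have 2: "V_ij adj E x (int i - 1) (int j) = (if i = 0 then {0} else corner Es E' UNIV (i - 1) j)"
      using V_corner[of j "i - 1"] j by (cases i) (auto simp: V_ij_def)
    let ?L = "V_ij adj E x (int i) (int j - 1) \<union> V_ij adj E x (int i - 1) (int j)"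
    have "(\<forall>u\<in>vec.span ?L. herm v u = 0) \<longleftrightarrow> (\<forall>u\<in>S.lower_corners i j. herm v u = 0)" for v
    proof -
      have "(\<forall>u\<in>vec.span ?L. herm v u = 0) \<longleftrightarrow> vec.span ?L \<subseteq> {u. herm v u = 0}" by auto
      also have "\<dots> \<longleftrightarrow> ?L \<subseteq> {u. herm v u = 0}"
        by (rule iffI, erule subset_trans[OF vec.span_superset],
            erule vec.span_minimal[OF _ subspace_herm_orthogonal_right])
      also have "\<dots> \<longleftrightarrow> (\<forall>u\<in>S.lower_corners i j. herm v u = 0)"
        unfolding 1 2 S.lower_corners_def by auto
      finally show ?thesis .
    qed
    then show ?thesis unfolding V_tilde_def S.split_part_def V_corner[OF j] by simp
  qed
  \<comment> \<open>In the notation of \<open>irreducible_module\<close> the displacement is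
    \<open>rho + tau + (rho' - rho) - D\<close>, that is, the level minus \<open>D\<close>.\<close>
  have level: "displacement adj E x W = int eta \<longleftrightarrow> S.level W = D + eta"
    if W: "irred_T_module adj E x W" for W eta
  proof -
    interpret M: irreducible_module D "adj_mat adj" E' th Es "dist_mat adj" inter_num
      "dual_adj E x" "\<lambda>i. of_nat CARD('x) * val (E 1) i" Fs "\<lambda>l h. q h 1 l" W
      using W unfolding irred_T_module_iff by (rule S.irreducible_moduleI)
    have fin: "finite (support Es W)" "finite (support E' W)"
      by (rule S.dual.finite_support S.finite_support)+
    have ne: "support Es W \<noteq> {}" "support E' W \<noteq> {}"
      using S.dual.support_nonempty S.support_nonempty M.sub M.nonzero by blast+
    have "endpoint adj x W = Min (support Es W)"
      unfolding endpoint_def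
    proof (rule Least_equality)
      show "acts_nonzero (Es (Min (support Es W))) W"
        using Min_in[OF fin(1) ne(1)] by (simp add: support_def)
      show "Min (support Es W) \<le> k" if "acts_nonzero (Es k) W" for k
        using that fin(1) by (simp add: support_def)
    qed
    moreover have "dual_endpoint E W = Min (support E' W)"
      unfolding dual_endpoint_def
    proof (rule Least_equality)
      have Min: "Min (support E' W) \<in> support E' W" by (rule Min_in[OF fin(2) ne(2)])
      then show "acts_nonzero (E (Min (support E' W))) W" by (simp add: support_E'_iff)
      show "Min (support E' W) \<le> k" if "acts_nonzero (E k) W" for k
      proof (cases "k \<le> D")
        case True
        then have "k \<in> support E' W" using that by (simp add: support_E'_iff)
        then show ?thesis using fin(2) by simp
      next
        \<comment> \<open>\<open>E\<close> is unspecified beyond \<open>D\<close>, so such a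
          \<open>k\<close> may act nontrivially; it still exceeds the minimum, which is at most
          \<open>D\<close>.\<close>
        case False
        moreover have "Min (support E' W) \<le> D" using Min by (simp only: support_E'_iff)
        ultimately show ?thesis by simp
      qed
    qed
    moreover have "module_diameter adj x W = int (Max (support Es W)) - int (Min (support Es W))"
    proof -
      have "{i. i \<le> D \<and> acts_nonzero (Es i) W} = support Es W"
        using S.dual.support_le[of _ W] by (auto simp: support_def)
      then have "module_diameter adj x W = int (card (support Es W)) - 1"
        by (simp add: module_diameter_def)
      also have "card (support Es W) = card {Min (support Es W)..Max (support Es W)}"
        using M.support_interval by simp
      moreover have "Min (support Es W) \<le> Max (support Es W)" using fin(1) ne(1) by simp
      ultimately show ?thesis by simp
    qed
    ultimately show ?thesis
      unfolding displacement_def S.level_def by linarith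
  qed
  have "V_disp adj E x eta =
      vec.span (\<Union> {V_tilde adj E x i j | i j. i \<le> D \<and> j \<le> D \<and> i + j = D + eta})" for eta
  proof -
    have "{W. irred_T_module adj E x W \<and> displacement adj E x W = int eta}
        = {W. irreducible_subspace (adj_mat adj) (dual_adj E x) W \<and> S.level W = D + eta}"
      by (rule Collect_cong, rule conj_cong) (simp_all only: level irred_T_module_iff)
    moreover have "{V_tilde adj E x i j | i j. i \<le> D \<and> j \<le> D \<and> i + j = D + eta}
        = {S.split_part i j | i j. i \<le> D \<and> j \<le> D \<and> i + j = D + eta}"
      using V_tilde by (intro Collect_cong) metis
    ultimately show ?thesis
      unfolding V_disp_def by (simp only: S.span_irreducibles_eq_span_split_parts)
  qed
  moreover have "V_ij adj E x (int i) (int j) = {0}" if "j \<le> D" "i + j < D" for i j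
    unfolding V_corner[OF that(1)] by (rule S.corner_eq_0_below_diameter[OF that(2)])
  moreover have "V_tilde adj E x i j = {0}" if "j \<le> D" "i + j < D" for i j
    unfolding V_tilde[OF that(1)] S.split_part_def S.corner_eq_0_below_diameter[OF that(2)] by auto
  ultimately show ?thesis by blast
qed

end

theorem mainTheorem7:
  fixes adj :: "'x::finite \<Rightarrow> 'x \<Rightarrow> bool"
    and E :: "nat \<Rightarrow> complex ^ 'x ^ 'x"
    and x :: 'x
    and D :: nat
  assumes "distance_regular adj"
    and "D = diameter adj"
    and "D \<ge> 3"
    and "Q_polynomial adj E"
  shows "(\<forall>eta\<le>D. V_disp adj E x eta =
            vec.span (\<Union> {V_tilde adj E x i j | i j. i \<le> D \<and> j \<le> D \<and> i + j = D + eta}))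
       \<and> (\<forall>i\<le>D. \<forall>j\<le>D. i + j < D \<longrightarrow> V_tilde adj E x i j = {0})
       \<and> (\<forall>i\<le>D. \<forall>j\<le>D. i + j < D \<longrightarrow> V_ij adj E x (int i) (int j) = {0})"
proof -
  obtain q where q: "idempotent_ordering adj E"
    "\<forall>i\<le>diameter adj. \<forall>j\<le>diameter adj. hadamard (E i) (E j) =
       msc (1 / of_nat CARD('x)) (\<Sum>h\<le>diameter adj. msc (q h i j) (E h))"
    "\<forall>h\<le>diameter adj. \<forall>i\<le>diameter adj. \<forall>j\<le>diameter adj.
       ((h > i + j \<or> i > h + j \<or> j > h + i) \<longrightarrow> q h i j = 0) \<and>
       ((h = i + j \<or> i = h + j \<or> j = h + i) \<longrightarrow> q h i j \<noteq> 0)"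
    using assms(4) unfolding Q_polynomial_def by blast
  interpret Q_polynomial_graph adj x E q
  proof
    show "distance_regular adj" by (rule assms(1))
    show "1 \<le> diameter adj" using assms(2,3) by simp
    show "idempotent_ordering adj E" by (rule q(1))
  qed (use q(2,3) in blast)+
  show ?thesis using displacement_theorem unfolding assms(2) .
qed

end
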